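(* Let $n\ge1$ and let $\lambda\in X_+$ be a dominant weight of $SL_{n+1}(\mathbb{C})$. Let $\mathbb{B}_1(\lambda)$ be the graph with vertices the elements of $\mathcal{B}(\lambda)$ and with an edge between $b$ and $b'$ if and only if $b=w(b')$ for some $w\in W$ or $b=f_n(b')$ (edges are undirected). Then the connected components of $\mathbb{B}_1(\lambda)$ are the LL atoms of $\mathcal{B}(\lambda)$.
   Context: $X$ is the weight lattice of $SL_{n+1}(\mathbb{C})$, $\Phi$ its root system (type $A_n$) with simple roots $\alpha_1,\dots,\alpha_n$ in the usual order and positive roots $\Phi_+$; $X_+$ is the set of dominant weights; $W\cong S_{n+1}$ is the Weyl group with simple reflections $s_i$. $\mathcal{B}(\lambda)$ is the crystal of the irreducible representation of highest weight $\lambda$, with weight map $\mathrm{wt}$ and crystal operators $e_i,f_i:\mathcal{B}(\lambda)\to\mathcal{B}(\lambda)\sqcup\{0\}$, $\mathrm{wt}(f_ib)=\mathrm{wt}(b)-\alpha_i$. $W$ acts on $\mathcal{B}(\lambda)$ by letting $s_i$ reverse each $\alpha_i$-string: $s_i(b)=f_i^k(b)$ if $k=\langle\mathrm{wt}(b),\alpha_i^\vee\rangle\ge0$, $s_i(b)=e_i^{-k}(b)$ if $k<0$. For $\alpha\in\Phi_+$ put $\tilde f_\alpha=wf_nw^{-1}$, where $w\in W$ is any element with $w(\alpha_n)=\alpha$ (this does not depend on the choice of $w$). The directed graph $\mathbb{B}^+(\lambda)$ has as vertices the elements $b\in\mathcal{B}(\lambda)$ with $\mathrm{wt}(b)\in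 X_+$, and an edge $b\to b'$ if $\tilde f_\alpha(b')=b$ for some $\alpha\in\Phi_+$. For $b\in\mathcal{B}(\lambda)$ let $\overline b$ be the unique element of the orbit $W\cdot b$ with dominant weight. Two elements $b,b'\in\mathcal{B}(\lambda)$ are LL-equivalent if $\overline b$ and $\overline{b'}$ lie in the same connected component of $\mathbb{B}^+(\lambda)$ (regarded as an undirected graph). The LL atoms are the equivalence classes of $\mathcal{B}(\lambda)$ under LL-equivalence. *)

theory Defs
  imports Main "HOL-Combinatorics.Permutations"
begin

section \<open>Weights, roots and the Weyl group of type A\<close>

text \<open>
  A weight \<open>\<mu>\<close> of \<open>SL(n+1)\<close> is given by its coordinates \<open>\<mu> i = \<langle>\<mu>, \<alpha>\<^sub>i\<^sup>\<or>\<rangle>\<close> (\<open>1 \<le> i \<le> n\<close>), that is,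
  \<open>\<mu> = \<Sum>i. \<mu> i \<cdot> \<omega>\<^sub>i\<close> in terms of the fundamental weights.
\<close>

definition weight_lattice :: "nat \<Rightarrow> (nat \<Rightarrow> int) set" where
  "weight_lattice n = {\<mu>. \<forall>i. i \<notin> {1..n} \<longrightarrow> \<mu> i = 0}"

definition dominant_weights :: "nat \<Rightarrow> (nat \<Rightarrow> int) set" where
  "dominant_weights n = {\<mu> \<in> weight_lattice n. \<forall>i\<in>{1..n}. 0 \<le> \<mu> i}"

text \<open>
  The pair \<open>(i, j)\<close> stands for the root \<open>\<epsilon>\<^sub>i - \<epsilon>\<^sub>j\<close>; thus \<open>\<alpha>\<^sub>i\<close> is \<open>(i, i + 1)\<close>.  The Weyl group
  consists of the permutations of \<open>{1..n+1}\<close> and acts by \<open>w (\<epsilon>\<^sub>i - \<epsilon>\<^sub>j) = \<epsilon>\<^bsub>w i\<^esub> - \<epsilon>\<^bsub>w j\<^esub>\<close>.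
\<close>

definition positive_roots :: "nat \<Rightarrow> (nat \<times> nat) set" where
  "positive_roots n = {(i, j). 1 \<le> i \<and> i < j \<and> j \<le> n + 1}"

definition simple_root :: "nat \<Rightarrow> nat \<times> nat" where
  "simple_root i = (i, Suc i)"

definition weyl_group :: "nat \<Rightarrow> (nat \<Rightarrow> nat) set" where
  "weyl_group n = {w. w permutes {1..n+1}}"

definition root_act :: "(nat \<Rightarrow> nat) \<Rightarrow> nat \<times> nat \<Rightarrow> nat \<times> nat" where
  "root_act w \<alpha> = map_prod w w \<alpha>"

definition simple_refl :: "nat \<Rightarrow> nat \<Rightarrow> nat" where
  "simple_refl i = transpose i (Suc i)"

definition weyl_product :: "nat list \<Rightarrow> nat \<Rightarrow> nat" where
  "weyl_product ks = foldr (\<lambda>i w. simple_refl i \<circ> w) ks id"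


section \<open>Tensor powers of the crystal of the vector representation\<close>

text \<open>
  The crystal of the vector representation has the elements \<open>1, \<dots>, n+1\<close> and arrows
  \<open>f\<^sub>i : i \<mapsto> i + 1\<close>.  A word \<open>x\<^sub>1 \<dots> x\<^sub>m\<close> is the element \<open>x\<^sub>1 \<otimes> \<dots> \<otimes> x\<^sub>m\<close> of a tensor
  power, with Kashiwara's tensor product rule
  \<open>f\<^sub>i (a \<otimes> b) = f\<^sub>i a \<otimes> b\<close> if \<open>\<phi>\<^sub>i a > \<epsilon>\<^sub>i b\<close>, and \<open>a \<otimes> f\<^sub>i b\<close> otherwise;
  \<open>e\<^sub>i (a \<otimes> b) = e\<^sub>i a \<otimes> b\<close> if \<open>\<phi>\<^sub>i a \<ge> \<epsilon>\<^sub>i b\<close>, and \<open>a \<otimes> e\<^sub>i b\<close> otherwise;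
  \<open>\<epsilon>\<^sub>i (a \<otimes> b) = \<epsilon>\<^sub>i a + max 0 (\<epsilon>\<^sub>i b - \<phi>\<^sub>i a)\<close> and \<open>\<phi>\<^sub>i (a \<otimes> b) = \<phi>\<^sub>i b + max 0 (\<phi>\<^sub>i a - \<epsilon>\<^sub>i b)\<close>
  (truncated subtraction below).  The element \<open>0\<close> adjoined to a crystal is \<open>None\<close>.
\<close>

definition f_letter :: "nat \<Rightarrow> nat \<Rightarrow> nat option" where
  "f_letter i x = (if x = i then Some (Suc i) else None)"

definition e_letter :: "nat \<Rightarrow> nat \<Rightarrow> nat option" where
  "e_letter i x = (if x = Suc i then Some i else None)"

definition phi_letter :: "nat \<Rightarrow> nat \<Rightarrow> nat" where
  "phi_letter i x = (if x = i then 1 else 0)"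

definition eps_letter :: "nat \<Rightarrow> nat \<Rightarrow> nat" where
  "eps_letter i x = (if x = Suc i then 1 else 0)"

fun eps :: "nat \<Rightarrow> nat list \<Rightarrow> nat" where
  "eps i [] = 0"
| "eps i (x # b) = eps_letter i x + (eps i b - phi_letter i x)"

fun phi :: "nat \<Rightarrow> nat list \<Rightarrow> nat" where
  "phi i [] = 0"
| "phi i (x # b) = phi i b + (phi_letter i x - eps i b)"

fun f_op :: "nat \<Rightarrow> nat list \<Rightarrow> nat list option" where
  "f_op i [] = None"
| "f_op i (x # b) =
    (if phi_letter i x > eps i b
     then map_option (\<lambda>y. y # b) (f_letter i x)
     else map_option (\<lambda>b'. x # b') (f_op i b))"

fun e_op :: "nat \<Rightarrow> nat list \<Rightarrow> nat list option" where
  "e_op i [] = None"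
| "e_op i (x # b) =
    (if phi_letter i x \<ge> eps i b
     then map_option (\<lambda>y. y # b) (e_letter i x)
     else map_option (\<lambda>b'. x # b') (e_op i b))"

definition wt :: "nat \<Rightarrow> nat list \<Rightarrow> nat \<Rightarrow> int" where
  "wt n b = (\<lambda>i. if i \<in> {1..n} then int (count_list b i) - int (count_list b (Suc i)) else 0)"


section \<open>The crystal of an irreducible representation\<close>

text \<open>
  \<open>B(\<Lambda>)\<close> is realised as the connected component of the tensor power containing the
  word \<open>1 \<dots> 1 2 \<dots> 2 \<dots> n \<dots> n\<close>, in which \<open>i\<close> occurs \<open>\<Lambda> i + \<dots> + \<Lambda> n\<close> times; this is an
  element of weight \<open>\<Lambda>\<close> annihilated by all \<open>e\<^sub>i\<close> (lemmas \<open>wt_highest_word\<close> and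
  \<open>e_op_highest_word\<close> below).
\<close>

definition highest_word :: "nat \<Rightarrow> (nat \<Rightarrow> int) \<Rightarrow> nat list" where
  "highest_word n \<Lambda> = concat (map (\<lambda>i. replicate (nat (\<Sum>j\<in>{i..n}. \<Lambda> j)) i) [1..<Suc n])"

inductive_set crystal :: "nat \<Rightarrow> (nat \<Rightarrow> int) \<Rightarrow> nat list set"
  for n :: nat and \<Lambda> :: "nat \<Rightarrow> int" where
  highest: "highest_word n \<Lambda> \<in> crystal n \<Lambda>"
| f_step: "b \<in> crystal n \<Lambda> \<Longrightarrow> i \<in> {1..n} \<Longrightarrow> f_op i b = Some b' \<Longrightarrow> b' \<in> crystal n \<Lambda>"
| e_step: "b \<in> crystal n \<Lambda> \<Longrightarrow> i \<in> {1..n} \<Longrightarrow> e_op i b = Some b' \<Longrightarrow> b' \<in> crystal n \<Lambda>"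

lemma count_list_concat: "count_list (concat xss) y = sum_list (map (\<lambda>xs. count_list xs y) xss)"
  by (induction xss) (auto)

lemma count_highest_word:
  "count_list (highest_word n \<Lambda>) i = (if i \<in> {1..n} then nat (\<Sum>j\<in>{i..n}. \<Lambda> j) else 0)"
proof -
  have rep: "count_list (replicate k x) y = (if x = y then k else 0)" for k and x y :: nat
    by (induction k) auto
  have "count_list (highest_word n \<Lambda>) i
      = (\<Sum>x\<in>{1..<Suc n}. if x = i then nat (\<Sum>j\<in>{x..n}. \<Lambda> j) else 0)"
    unfolding highest_word_def count_list_concat map_map o_def rep
    by (simp only: sum_list_distinct_conv_sum_set[OF distinct_upt] set_upt)
  also have "\<dots> = (if i \<in> {1..n} then nat (\<Sum>j\<in>{i..n}. \<Lambda> j) else 0)"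
    by (auto simp: sum.delta)
  finally show ?thesis .
qed

lemma wt_highest_word:
  assumes "\<Lambda> \<in> dominant_weights n"
  shows "wt n (highest_word n \<Lambda>) = \<Lambda>"
proof
  fix i
  show "wt n (highest_word n \<Lambda>) i = \<Lambda> i"
  proof (cases "i \<in> {1..n}")
    case True
    have nonneg: "0 \<le> (\<Sum>j\<in>{k..n}. \<Lambda> j)" if "1 \<le> k" for k
      using assms that by (intro sum_nonneg) (auto simp: dominant_weights_def)
    have "(\<Sum>j\<in>{i..n}. \<Lambda> j) = \<Lambda> i + (\<Sum>j\<in>{Suc i..n}. \<Lambda> j)"
      using True by (simp add: sum.atLeast_Suc_atMost)
    then show ?thesis
      using True nonneg[of i] nonneg[of "Suc i"] by (auto simp: wt_def count_highest_word)
  next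
    case False
    then show ?thesis
      using assms by (auto simp: wt_def dominant_weights_def weight_lattice_def)
  qed
qed

lemma e_op_None_iff: "e_op i b = None \<longleftrightarrow> eps i b = 0"
  by (induction b) (auto simp: e_letter_def eps_letter_def phi_letter_def)

lemma eps_append: "eps i (b @ c) = eps i b + (eps i c - phi i b)"
  and phi_append: "phi i (b @ c) = phi i c + (phi i b - eps i c)"
  by (induction b) auto

lemma eps_phi_irrelevant:
  assumes "i \<notin> set b" "Suc i \<notin> set b"
  shows "eps i b = 0" "phi i b = 0"
  using assms by (induction b) (auto simp: eps_letter_def phi_letter_def)

lemma e_op_highest_word:
  assumes "\<Lambda> \<in> dominant_weights n" and "i \<in> {1..n}"
  shows "e_op i (highest_word n \<Lambda>) = None"
proof -
  define r where "r = (\<lambda>i. replicate (nat (\<Sum>j\<in>{i..n}. \<Lambda> j)) i)"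
  define m where "m = (\<lambda>i. nat (\<Sum>j\<in>{i..n}. \<Lambda> j))"
  have split: "[1..<Suc n] = [1..<i] @ i # [Suc i..<Suc n]"
    using assms(2) upt_add_eq_append[of 1 i "Suc n - i"]
    by (simp add: upt_conv_Cons del: upt_Suc)
  have hw: "highest_word n \<Lambda> =
      concat (map r [1..<i]) @ r i @ concat (map r [Suc i..<Suc n])"
    unfolding highest_word_def r_def split by simp
  have pre: "eps i (concat (map r [1..<i])) = 0" "phi i (concat (map r [1..<i])) = 0"
    by (rule eps_phi_irrelevant; auto simp: r_def)+
  have eps_i: "eps i (replicate k i) = 0" for k
    by (induction k) (auto simp: eps_letter_def)
  have phi_i: "phi i (replicate k i) = k" for k
    by (induction k) (auto simp: phi_letter_def eps_i)
  have eps_Suc: "eps i (replicate k (Suc i)) = k" for k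
    by (induction k) (auto simp: eps_letter_def phi_letter_def)
  have post: "eps i (concat (map r [Suc i..<Suc n])) \<le> m (Suc i)"
  proof (cases "i < n")
    case True
    have "concat (map r [Suc i..<Suc n]) = r (Suc i) @ concat (map r [Suc (Suc i)..<Suc n])"
      using True by (subst upt_conv_Cons) auto
    moreover have "eps i (concat (map r [Suc (Suc i)..<Suc n])) = 0"
      by (rule eps_phi_irrelevant) (auto simp: r_def)
    ultimately show ?thesis
      by (simp add: eps_append r_def m_def eps_Suc del: upt_Suc)
  qed auto
  have "(\<Sum>j\<in>{i..n}. \<Lambda> j) = \<Lambda> i + (\<Sum>j\<in>{Suc i..n}. \<Lambda> j)"
    using assms(2) by (simp add: sum.atLeast_Suc_atMost)
  moreover have "0 \<le> \<Lambda> i"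
    using assms by (auto simp: dominant_weights_def)
  ultimately have "m (Suc i) \<le> m i"
    unfolding m_def by (intro nat_mono) auto
  moreover have "eps i (r i) = 0" "phi i (r i) = m i"
    by (simp_all add: r_def m_def eps_i phi_i)
  ultimately have "eps i (highest_word n \<Lambda>) = 0"
    unfolding hw eps_append pre using post by simp
  then show ?thesis
    by (simp add: e_op_None_iff)
qed


section \<open>The Weyl group action\<close>

fun iter_op :: "('a \<Rightarrow> 'a option) \<Rightarrow> nat \<Rightarrow> 'a \<Rightarrow> 'a option" where
  "iter_op g 0 b = Some b"
| "iter_op g (Suc k) b = Option.bind (iter_op g k b) g"

definition crystal_refl :: "nat \<Rightarrow> nat \<Rightarrow> nat list \<Rightarrow> nat list" where
  "crystal_refl n i b =
    (if wt n b i \<ge> 0 then the (iter_op (f_op i) (nat (wt n b i)) b)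
     else the (iter_op (e_op i) (nat (- wt n b i)) b))"

text \<open>
  \<open>w\<close> acts as \<open>s\<^bsub>k1\<^esub> \<dots> s\<^bsub>kr\<^esub>\<close> for an expression of \<open>w\<close> as a product of simple reflections; the
  choice of the expression is immaterial, as the crystal reflections satisfy the Coxeter
  relations of the Weyl group.
\<close>

definition weyl_act :: "nat \<Rightarrow> (nat \<Rightarrow> nat) \<Rightarrow> nat list \<Rightarrow> nat list" where
  "weyl_act n w b =
    foldr (crystal_refl n) (SOME ks. set ks \<subseteq> {1..n} \<and> weyl_product ks = w) b"

text \<open>
  \<open>f_root n \<alpha>\<close> is \<open>w f\<^sub>n w\<^sup>-\<^sup>1\<close> with \<open>w (\<alpha>\<^sub>n) = \<alpha>\<close>; it does not depend on the choice of such a \<open>w\<close>.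
\<close>

definition f_root :: "nat \<Rightarrow> nat \<times> nat \<Rightarrow> nat list \<Rightarrow> nat list option" where
  "f_root n \<alpha> b =
    (let w = (SOME w. w \<in> weyl_group n \<and> root_act w (simple_root n) = \<alpha>)
     in map_option (weyl_act n w) (f_op n (weyl_act n (inv w) b)))"

definition dominant_rep :: "nat \<Rightarrow> nat list \<Rightarrow> nat list" where
  "dominant_rep n b =
    (THE c. (\<exists>w\<in>weyl_group n. c = weyl_act n w b) \<and> wt n c \<in> dominant_weights n)"


section \<open>Graphs, LL atoms\<close>

text \<open>Directions of edges are ignored, and only edges between elements of \<open>V\<close> count.\<close>

definition connected_components :: "'a set \<Rightarrow> ('a \<times> 'a) set \<Rightarrow> 'a set set" where
  "connected_components V E =
    V // {(x, y). x \<in> V \<and> y \<in> V \<and> (x, y) \<in> ((E \<inter> V \<times> V) \<union> (E \<inter> V \<times> V)\<inverse>)\<^sup>*}"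

definition Bplus_vertices :: "nat \<Rightarrow> (nat \<Rightarrow> int) \<Rightarrow> nat list set" where
  "Bplus_vertices n \<Lambda> = {b \<in> crystal n \<Lambda>. wt n b \<in> dominant_weights n}"

definition Bplus_edges :: "nat \<Rightarrow> (nat \<Rightarrow> int) \<Rightarrow> (nat list \<times> nat list) set" where
  "Bplus_edges n \<Lambda> = {(b, b'). b \<in> Bplus_vertices n \<Lambda> \<and> b' \<in> Bplus_vertices n \<Lambda> \<and>
    (\<exists>\<alpha>\<in>positive_roots n. f_root n \<alpha> b' = Some b)}"

definition LL_equivalence :: "nat \<Rightarrow> (nat \<Rightarrow> int) \<Rightarrow> (nat list \<times> nat list) set" where
  "LL_equivalence n \<Lambda> = {(b, b'). b \<in> crystal n \<Lambda> \<and> b' \<in> crystal n \<Lambda> \<and>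
    (\<exists>C\<in>connected_components (Bplus_vertices n \<Lambda>) (Bplus_edges n \<Lambda>).
      dominant_rep n b \<in> C \<and> dominant_rep n b' \<in> C)}"

definition LL_atoms :: "nat \<Rightarrow> (nat \<Rightarrow> int) \<Rightarrow> nat list set set" where
  "LL_atoms n \<Lambda> = crystal n \<Lambda> // LL_equivalence n \<Lambda>"

definition B1_edges :: "nat \<Rightarrow> (nat \<Rightarrow> int) \<Rightarrow> (nat list \<times> nat list) set" where
  "B1_edges n \<Lambda> = {(b, b'). b \<in> crystal n \<Lambda> \<and> b' \<in> crystal n \<Lambda> \<and>
    ((\<exists>w\<in>weyl_group n. b = weyl_act n w b') \<or> f_op n b' = Some b)}"

end

theory Submission imports Defs
begin

text \<open>
  Both partitions of the crystal are generated by the Weyl group action together with some set of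
  the operators \<open>w f\<^sub>n w\<^sup>-\<^sup>1\<close>.  An edge between dominant elements, \<open>c = w (f\<^sub>n (w\<^sup>-\<^sup>1 c'))\<close>, is by
  construction a path \<open>c' \<rightarrow> w\<^sup>-\<^sup>1 c' \<rightarrow> f\<^sub>n (w\<^sup>-\<^sup>1 c') \<rightarrow> c\<close> of the graph of the theorem, and every
  element is joined to its dominant representative by a Weyl group edge; so an LL atom lies inside
  one component.  For the converse it must be shown that \<open>c = f\<^sub>n b\<close> implies that the dominant
  representatives of \<open>b\<close> and \<open>c\<close> are connected among dominant elements.  If
  \<open>\<langle>wt b, \<alpha>\<^sub>n\<^sup>\<or>\<rangle> \<ge> 2\<close>, then a single \<open>w\<close> makes both weights dominant (sort the letters by the sum
  of their multiplicities in \<open>b\<close> and \<open>c\<close>), \<open>w \<alpha>\<^sub>n\<close> is positive, and \<open>w c\<close> is obtained from \<open>w b\<close> by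
  the operator of the root \<open>w \<alpha>\<^sub>n\<close>: this is an edge.  If the pairing is \<open>1\<close>, then \<open>c = s\<^sub>n b\<close> and the
  representatives agree.  If it is at most \<open>0\<close>, then \<open>s\<^sub>n\<close> turns the arrow around:
  \<open>s\<^sub>n b = f\<^sub>n (s\<^sub>n c)\<close> with pairing at least \<open>2\<close> at \<open>s\<^sub>n c\<close>.  This is
  \<open>dominant_reps_of_f_op_connected\<close>.

  The substance lies in the Weyl group action.  It is given through a chosen expression of \<open>w\<close> by
  simple reflections, so one has to know that the reflections satisfy all relations of the
  symmetric group, that an element of the orbit with given weight is unique when that weight is
  dominant, and that the choice of \<open>w\<close> with \<open>w \<alpha>\<^sub>n = \<alpha>\<close> is immaterial.  The first two follow
  from one fact (\<open>foldr_crystal_refl_determined_by_content\<close>): two products of crystal reflections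
  that carry \<open>b\<close> to words with the same number of occurrences of each letter carry \<open>b\<close> to the same
  word.  The proof avoids the braid relations.  Crystal reflections commute with the elementary
  Knuth transformations at a fixed position, because these commute with all \<open>f\<^sub>i\<close>, and with the
  cyclic rotation of words (\<open>mirrored_rotate1\<close>).  These maps are injective and preserve the content,
  and together they bring every word into weakly decreasing order (\<open>carried_to_descending\<close>).
  Reflections preserve the set of weakly decreasing words, and such a word is determined by its
  content.  The third point follows from \<open>f\<^sub>n\<close> commuting with \<open>s\<^sub>i\<close> for \<open>i \<le> n - 2\<close>, since these
  generate the stabilizer of \<open>\<alpha>\<^sub>n\<close>.
\<close>

section \<open>The strings of the tensor crystal\<close>

lemma phi_minus_eps: "int (phi i b) - int (eps i b) = int (count_list b i) - int (count_list b (Suc i))"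
  by (induction b) (auto simp: phi_letter_def eps_letter_def)

lemma f_op_None_iff: "f_op i b = None \<longleftrightarrow> phi i b = 0"
  by (induction b) (auto simp: f_letter_def phi_letter_def)

lemma f_op_eps_phi:
  "f_op i b = Some c \<Longrightarrow> eps i c = Suc (eps i b) \<and> phi i b = Suc (phi i c)"
  by (induction b arbitrary: c)
    (auto simp: f_letter_def phi_letter_def eps_letter_def split: if_splits)

lemma e_op_f_op_iff: "e_op i c = Some b \<longleftrightarrow> f_op i b = Some c"
proof
  show "f_op i b = Some c \<Longrightarrow> e_op i c = Some b"
  proof (induction b arbitrary: c)
    case (Cons x b)
    then show ?case
      by (auto simp: f_letter_def e_letter_def phi_letter_def f_op_eps_phi split: if_splits)
  qed simp
  show "e_op i c = Some b \<Longrightarrow> f_op i b = Some c"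
  proof (induction c arbitrary: b)
    case (Cons x c)
    show ?case
    proof (cases "phi_letter i x \<ge> eps i c")
      case True
      with Cons.prems show ?thesis
        by (auto simp: f_letter_def e_letter_def phi_letter_def split: if_splits)
    next
      case False
      with Cons.prems obtain z where z: "e_op i c = Some z" "b = x # z"
        by auto
      from Cons.IH[OF z(1)] have "f_op i z = Some c" .
      with False z(2) show ?thesis
        using f_op_eps_phi[of i z c] by simp
    qed
  qed simp
qed

lemma count_f_op:
  "f_op i b = Some c \<Longrightarrow>
    int (count_list c j) = int (count_list b j) - (if j = i then 1 else 0) + (if j = Suc i then 1 else 0)"
  by (induction b arbitrary: c)
    (auto simp: f_letter_def phi_letter_def split: if_splits)

section \<open>Elementary Knuth transformations\<close>

text \<open>
  The operator \<open>f\<^sub>i\<close> cancels a letter \<open>i\<close> with a later letter \<open>i + 1\<close>, so the rows of tableaux are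
  the weakly decreasing words.  The elementary Knuth transformations then read
  \<open>x z y \<leftrightarrow> z x y\<close> for \<open>x < y \<le> z\<close> and \<open>y z x \<leftrightarrow> y x z\<close> for \<open>x \<le> y < z\<close>.  No word of length three
  is subject to both, so they combine into one involution.
\<close>

fun knuth_swap :: "nat list \<Rightarrow> nat list" where
  "knuth_swap (a # b # c # v) =
    (if a < c \<and> c \<le> b \<or> b < c \<and> c \<le> a then b # a # c # v
     else if b \<le> a \<and> a < c \<or> c \<le> a \<and> a < b then a # c # b # v
     else a # b # c # v)"
| "knuth_swap v = v"

fun knuth_swap_at :: "nat \<Rightarrow> nat list \<Rightarrow> nat list" where
  "knuth_swap_at 0 b = knuth_swap b"
| "knuth_swap_at (Suc p) [] = []"
| "knuth_swap_at (Suc p) (x # b) = x # knuth_swap_at p b"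

lemma knuth_swap_swap: "knuth_swap (knuth_swap b) = b"
  by (induction b rule: knuth_swap.induct) auto

lemma eps_knuth_swap: "eps i (knuth_swap b) = eps i b"
  by (induction b rule: knuth_swap.induct)
    (auto simp: eps_letter_def phi_letter_def)

text \<open>
  On words of length three the transformation is the isomorphism between the two components of the
  tensor cube that belong to the partition \<open>(2, 1)\<close>, and the identity elsewhere.  A tail \<open>v\<close> enters
  only through \<open>f\<^sub>i v\<close> and the number \<open>\<epsilon>\<^sub>i v\<close>, and only the values \<open>0\<close>, \<open>1\<close> and \<open>\<ge> 2\<close> of the latter
  make a difference, since a factor \<open>a b c\<close> subject to a transformation cannot consist of three
  letters \<open>i\<close>.
\<close>

lemma f_op_knuth_swap: "f_op i (knuth_swap b) = map_option knuth_swap (f_op i b)"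
proof (induction b rule: knuth_swap.induct)
  case (1 a b c v)
  have letter: "x < i \<or> x = i \<or> x = Suc i \<or> Suc i < x" for x :: nat
    by linarith
  have m: "eps i v = 0 \<or> eps i v = 1 \<or> eps i v \<ge> 2" by linarith
  show ?case
    using letter[of a] letter[of b] letter[of c] m
    by (elim disjE) (cases "f_op i v"; simp add: eps_letter_def phi_letter_def f_letter_def; fail)+
qed (auto simp: f_letter_def phi_letter_def option.map_comp o_def eps_letter_def)

section \<open>Crystal reflections\<close>

lemma iter_op_Suc_front: "iter_op g (Suc k) b = Option.bind (g b) (iter_op g k)"
proof (induction k)
  case 0
  then show ?case by (cases "g b") auto
next
  case (Suc k)
  have "iter_op g (Suc (Suc k)) b = Option.bind (Option.bind (g b) (iter_op g k)) g"
    using Suc by simp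
  then show ?case by (cases "g b") auto
qed

lemma iter_f_op_stats:
  "iter_op (f_op i) k b = Some c \<Longrightarrow>
    eps i c = eps i b + k \<and> phi i b = phi i c + k \<and>
    int (count_list c j) = int (count_list b j) - (if j = i then int k else 0) + (if j = Suc i then int k else 0)"
proof (induction k arbitrary: c)
  case (Suc k)
  then obtain d where d: "iter_op (f_op i) k b = Some d" "f_op i d = Some c"
    by (auto simp: bind_eq_Some_conv)
  show ?case
    using Suc.IH[OF d(1)] f_op_eps_phi[OF d(2)] count_f_op[OF d(2), of j] by auto
qed simp

lemma iter_f_op_defined: "k \<le> phi i b \<Longrightarrow> \<exists>c. iter_op (f_op i) k b = Some c"
proof (induction k)
  case (Suc k)
  then obtain d where d: "iter_op (f_op i) k b = Some d"
    by auto
  with Suc.prems iter_f_op_stats[OF d] have "f_op i d \<noteq> None"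
    by (auto simp: f_op_None_iff)
  with d show ?case by auto
qed simp

lemma iter_e_op_iff: "iter_op (e_op i) k c = Some b \<longleftrightarrow> iter_op (f_op i) k b = Some c"
proof (induction k arbitrary: c)
  case (Suc k)
  have "iter_op (e_op i) (Suc k) c = Some b \<longleftrightarrow> (\<exists>d. e_op i c = Some d \<and> iter_op (e_op i) k d = Some b)"
    unfolding iter_op_Suc_front by (simp add: bind_eq_Some_conv)
  then show ?case
    by (auto simp: Suc.IH e_op_f_op_iff bind_eq_Some_conv)
qed auto

lemma iter_e_op_defined: "k \<le> eps i b \<Longrightarrow> \<exists>c. iter_op (e_op i) k b = Some c"
proof (induction k)
  case (Suc k)
  then obtain d where d: "iter_op (e_op i) k b = Some d"
    by auto
  with Suc.prems iter_f_op_stats[of i k d b] have "e_op i d \<noteq> None"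
    by (auto simp: e_op_None_iff iter_e_op_iff)
  with d show ?case by auto
qed simp

text \<open>
  The reflection \<open>s\<^sub>i\<close> in relational form: \<open>b\<close> lies in the upper half of its \<open>i\<close>-string and \<open>c\<close> is
  the mirror image of \<open>b\<close>.  Restricting to the upper half leaves only iterates of \<open>f\<^sub>i\<close> to consider;
  as \<open>s\<^sub>i\<close> is an involution, \<open>mirrored_crystal_refl\<close> and \<open>crystal_refl_of_mirrored\<close> recover it from
  this relation.
\<close>

definition mirrored :: "nat \<Rightarrow> nat list \<Rightarrow> nat list \<Rightarrow> bool" where
  "mirrored i b c \<longleftrightarrow>
    (\<exists>k. iter_op (f_op i) k b = Some c \<and> int k = int (count_list b i) - int (count_list b (Suc i)))"

lemma mirrored_count:
  assumes "mirrored i b c"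
  shows "count_list c (simple_refl i j) = count_list b j"
proof -
  obtain k where k: "iter_op (f_op i) k b = Some c"
      "int k = int (count_list b i) - int (count_list b (Suc i))"
    using assms by (auto simp: mirrored_def)
  show ?thesis
    using iter_f_op_stats[OF k(1), of "simple_refl i j"] k(2)
    by (auto simp: simple_refl_def transpose_def split: if_splits)
qed

lemma crystal_refl_outside:
  assumes "i \<notin> {1..n}"
  shows "crystal_refl n i b = b"
proof -
  have "wt n b i = 0" using assms by (simp only: wt_def if_False)
  then show ?thesis by (simp add: crystal_refl_def)
qed

lemma mirrored_crystal_refl:
  assumes "i \<in> {1..n}"
  shows "mirrored i b (crystal_refl n i b) \<or> mirrored i (crystal_refl n i b) b"
proof -
  define d where "d = int (count_list b i) - int (count_list b (Suc i))"
  have wt: "wt n b i = d" using assms by (simp add: wt_def d_def)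
  have string: "int (phi i b) - int (eps i b) = d" by (simp add: phi_minus_eps d_def)
  show ?thesis
  proof (cases "d \<ge> 0")
    case True
    then have "nat d \<le> phi i b" using string by linarith
    from iter_f_op_defined[OF this] obtain c where c: "iter_op (f_op i) (nat d) b = Some c" by auto
    with True wt have "crystal_refl n i b = c" by (simp add: crystal_refl_def)
    moreover have "int (nat d) = int (count_list b i) - int (count_list b (Suc i))"
      using True unfolding d_def by simp
    with c have "mirrored i b c" unfolding mirrored_def by blast
    ultimately show ?thesis by simp
  next
    case False
    then have "nat (- d) \<le> eps i b" using string by linarith
    from iter_e_op_defined[OF this] obtain c where c: "iter_op (e_op i) (nat (- d)) b = Some c" by auto
    with False wt have "crystal_refl n i b = c" by (simp add: crystal_refl_def)
    moreover have f: "iter_op (f_op i) (nat (- d)) c = Some b"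
      using c by (simp add: iter_e_op_iff)
    have "int (nat (- d)) = int (count_list c i) - int (count_list c (Suc i))"
      using False iter_f_op_stats[OF f, of i] iter_f_op_stats[OF f, of "Suc i"]
      unfolding d_def by simp
    with f have "mirrored i c b" unfolding mirrored_def by blast
    ultimately show ?thesis by simp
  qed
qed

lemma crystal_refl_of_mirrored:
  assumes "i \<in> {1..n}" and "mirrored i b c"
  shows "crystal_refl n i b = c" and "crystal_refl n i c = b"
proof -
  obtain k where k: "iter_op (f_op i) k b = Some c"
      "int k = int (count_list b i) - int (count_list b (Suc i))"
    using assms(2) by (auto simp: mirrored_def)
  have wt_b: "wt n b i = int k" using assms(1) k(2) by (simp add: wt_def)
  then show "crystal_refl n i b = c" using k(1) by (simp add: crystal_refl_def)
  have wt_c: "wt n c i = - int k"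
    using iter_f_op_stats[OF k(1), of i] iter_f_op_stats[OF k(1), of "Suc i"] assms(1) k(2)
    by (simp add: wt_def)
  have "iter_op (e_op i) k c = Some b" using k(1) by (simp add: iter_e_op_iff)
  then show "crystal_refl n i c = b"
    using wt_c k(1) by (cases "k = 0") (auto simp: crystal_refl_def)
qed

text \<open>
  The criterion by which commutation with a reflection is verified for rotation and for Knuth
  transformations.
\<close>

lemma crystal_refl_commute:
  assumes "\<And>b c. mirrored i b c \<Longrightarrow> mirrored i (g b) (g c)"
  shows "crystal_refl n i (g b) = g (crystal_refl n i b)"
proof (cases "i \<in> {1..n}")
  case True
  from mirrored_crystal_refl[OF this, of b] show ?thesis
  proof
    assume "mirrored i b (crystal_refl n i b)"
    from crystal_refl_of_mirrored(1)[OF True assms[OF this]] show ?thesis .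
  next
    assume "mirrored i (crystal_refl n i b) b"
    from crystal_refl_of_mirrored(2)[OF True assms[OF this]] show ?thesis .
  qed
qed (simp add: crystal_refl_outside)

lemma count_crystal_refl:
  assumes "i \<in> {1..n}"
  shows "count_list (crystal_refl n i b) (simple_refl i j) = count_list b j"
  using mirrored_crystal_refl[OF assms, of b]
proof
  assume "mirrored i b (crystal_refl n i b)"
  then show ?thesis by (rule mirrored_count)
next
  assume "mirrored i (crystal_refl n i b) b"
  from mirrored_count[OF this, of "simple_refl i j"] show ?thesis
    unfolding simple_refl_def transpose_involutory by (rule sym)
qed

lemma f_op_append:
  "f_op i (b @ c) =
    (if phi i b > eps i c then map_option (\<lambda>b'. b' @ c) (f_op i b)
     else map_option (\<lambda>c'. b @ c') (f_op i c))"
proof (induction b)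
  case Nil
  have "(@) [] = (id :: nat list \<Rightarrow> nat list)" by (rule ext) simp
  then show ?case by (simp add: option.map_id)
next
  case (Cons x b)
  show ?case
  proof (cases "phi_letter i x > eps i b + (eps i c - phi i b)")
    case True
    from this have A: "phi_letter i x > eps i b" "phi i (x # b) > eps i c"
      unfolding phi.simps by linarith+
    with True show ?thesis
      unfolding append_Cons f_op.simps eps_append
      by (cases "f_letter i x") (simp_all del: phi.simps)
  next
    case False
    then have B: "phi i (x # b) > eps i c \<longleftrightarrow> phi i b > eps i c"
      and C: "phi_letter i x > eps i b \<Longrightarrow> \<not> phi i b > eps i c"
      unfolding phi.simps by linarith+
    show ?thesis
    proof (cases "phi i b > eps i c")
      case True
      then show ?thesis
      unfolding append_Cons f_op.simps eps_append B  Cons.IH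
       using C False
      by (cases "f_op i b") (simp_all)
    next
      case F: False
      then show ?thesis
      unfolding append_Cons f_op.simps eps_append B  Cons.IH
       using False
      by (cases "f_op i c") (simp_all)
   qed
  qed
qed

lemma iter_f_op_append:
  assumes "k + eps i c \<le> phi i b"
  shows "iter_op (f_op i) k (b @ c) = map_option (\<lambda>b'. b' @ c) (iter_op (f_op i) k b)"
  using assms
proof (induction k)
  case (Suc k)
  then obtain d where d: "iter_op (f_op i) k b = Some d"
    using iter_f_op_defined[of k i b] by auto
  with Suc iter_f_op_stats[OF d] show ?case by (auto simp: f_op_append)
qed simp

lemma iter_f_op_Cons:
  assumes "phi_letter i x \<le> eps i b"
  shows "iter_op (f_op i) k (x # b) = map_option ((#) x) (iter_op (f_op i) k b)"
proof (induction k)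
  case (Suc k)
  show ?case
  proof (cases "iter_op (f_op i) k b")
    case (Some d)
    then show ?thesis using Suc iter_f_op_stats[OF Some] assms by auto
  qed (simp add: Suc)
qed simp

text \<open>
  Match letters \<open>i\<close> and \<open>i + 1\<close> as brackets around a circle.  In a word whose unmatched letters form
  \<open>(i + 1)\<^sup>p i\<^sup>q\<close>, this matches in addition \<open>min p q\<close> pairs, and the reflection changes exactly the
  letters that remain.  So it does not depend on where the circle is cut.  In the proof the
  first letter \<open>x\<close> moves to the end; the only case in which the iterates of \<open>f\<^sub>i\<close> change it is that
  of an unmatched \<open>i\<close>, which is changed first in \<open>x v\<close> and last in \<open>v x\<close>.
\<close>

lemma mirrored_rotate1:
  assumes "mirrored i b c"
  shows "mirrored i (rotate1 b) (rotate1 c)"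
proof (cases b)
  case Nil
  then show ?thesis using assms
    by (metis f_op.simps(1) iter_op.simps(1) iter_op_Suc_front bind.simps(1) mirrored_def
        not0_implies_Suc option.distinct(1) option.inject rotate1.simps(1))
next
  case (Cons x v)
  obtain k where k: "iter_op (f_op i) k b = Some c"
      "int k = int (count_list b i) - int (count_list b (Suc i))"
    using assms by (auto simp: mirrored_def)
  have count: "count_list (rotate1 b) j = count_list b j" for j
    by (simp add: Cons)
  have string: "int (phi i v) - int (eps i v) = int k - (if x = i then 1 else 0) + (if x = Suc i then 1 else 0)"
    using k(2) by (auto simp: Cons phi_minus_eps)
  have "iter_op (f_op i) k (rotate1 b) = Some (rotate1 c)"
  proof (cases "phi_letter i x \<le> eps i v")
    case True
    with k(1) obtain d where d: "iter_op (f_op i) k v = Some d" "c = x # d"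
      by (auto simp: Cons iter_f_op_Cons)
    have "k + eps i [x] \<le> phi i v"
      using True string by (auto simp: phi_letter_def eps_letter_def split: if_splits)
    from iter_f_op_append[OF this] show ?thesis using d by (simp add: Cons)
  next
    case False
    then have x: "x = i" and eps0: "eps i v = 0" by (auto simp: phi_letter_def split: if_splits)
    show ?thesis
    proof (cases k)
      case 0
      then show ?thesis using k(1) by simp
    next
      case (Suc l)
      have "f_op i b = Some (Suc i # v)"
        by (simp add: Cons x eps0 phi_letter_def f_letter_def)
      then have "iter_op (f_op i) l (Suc i # v) = Some c"
        using k(1) Suc by (simp only: iter_op_Suc_front) simp
      then obtain d where d: "iter_op (f_op i) l v = Some d" "c = Suc i # d"
        by (auto simp: iter_f_op_Cons phi_letter_def)
      have phi_v: "phi i v = l" using string eps0 x Suc by simp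
      then have "iter_op (f_op i) l (v @ [i]) = Some (d @ [i])"
        using iter_f_op_append[of l i "[i]" v] d(1) by (simp add: eps_letter_def)
      moreover have "phi i d = 0"
        using iter_f_op_stats[OF d(1)] phi_v by simp
      ultimately show ?thesis
        using d(2) by (simp add: Cons x Suc f_op_append f_letter_def phi_letter_def eps_letter_def)
    qed
  qed
  then show ?thesis
    using k(2) unfolding mirrored_def count by blast
qed

lemma eps_knuth_swap_at: "eps i (knuth_swap_at p b) = eps i b"
  by (induction p b rule: knuth_swap_at.induct) (simp_all add: eps_knuth_swap)

lemma f_op_knuth_swap_at: "f_op i (knuth_swap_at p b) = map_option (knuth_swap_at p) (f_op i b)"
proof (induction p b rule: knuth_swap_at.induct)
  case (1 b)
  have "knuth_swap_at 0 = knuth_swap" by (rule ext) simp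
  then show ?case by (simp add: f_op_knuth_swap)
next
  case (3 p x b)
  then show ?case
    by (auto simp: eps_knuth_swap_at option.map_comp o_def f_letter_def)
qed simp

lemma count_knuth_swap_at: "count_list (knuth_swap_at p b) j = count_list b j"
proof -
  have "count_list (knuth_swap b) j = count_list b j" for b
  proof (induction b rule: knuth_swap.induct)
    case (1 a b c v)
    have "count_list (b # a # c # v) j = count_list (a # b # c # v) j"
      and "count_list (a # c # b # v) j = count_list (a # b # c # v) j"
      by simp_all
    then show ?case
      unfolding knuth_swap.simps if_distrib[of "\<lambda>b. count_list b j"] by (simp only: if_cancel)
  qed simp_all
  then show ?thesis
    by (induction p b rule: knuth_swap_at.induct) auto
qed

lemma knuth_swap_at_swap_at: "knuth_swap_at p (knuth_swap_at p b) = b"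
  by (induction p b rule: knuth_swap_at.induct) (auto simp: knuth_swap_swap)

lemma mirrored_knuth_swap_at:
  assumes "mirrored i b c"
  shows "mirrored i (knuth_swap_at p b) (knuth_swap_at p c)"
proof -
  have "iter_op (f_op i) k (knuth_swap_at p b) = map_option (knuth_swap_at p) (iter_op (f_op i) k b)" for k
  proof (induction k)
    case (Suc k)
    then show ?case
      by (cases "iter_op (f_op i) k b") (auto simp: f_op_knuth_swap_at)
  qed simp
  then show ?thesis
    using assms by (auto simp: mirrored_def count_knuth_swap_at)
qed

section \<open>Weakly decreasing words\<close>

abbreviation descending :: "nat list \<Rightarrow> bool" where
  "descending \<equiv> sorted_wrt (\<ge>)"

text \<open>
  All letters \<open>i + 1\<close> precede all letters \<open>i\<close>, so nothing cancels.
\<close>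

lemma eps_descending: "descending b \<Longrightarrow> eps i b = count_list b (Suc i)"
proof (induction b)
  case (Cons x b)
  then have "count_list b (Suc i) = 0" if "x = i"
    using that by (auto simp: count_list_0_iff)
  with Cons show ?case by (auto simp: eps_letter_def phi_letter_def)
qed simp

lemma f_op_set: "f_op i b = Some c \<Longrightarrow> i \<in> set b \<and> Suc i \<in> set c \<and> set c \<subseteq> insert (Suc i) (set b) \<and> set b \<subseteq> insert i (set c)"
proof (induction b arbitrary: c)
  case (Cons x b)
  show ?case
  proof (cases "phi_letter i x > eps i b")
    case True
    with Cons.prems show ?thesis
      by (auto simp: f_letter_def split: if_splits)
  next
    case False
    with Cons.prems obtain d where "f_op i b = Some d" "c = x # d" by auto
    with Cons.IH show ?thesis by auto
  qed
qed simp

text \<open>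
  In a weakly decreasing word \<open>f\<^sub>i\<close> changes the first \<open>i\<close>, which has only letters \<open>\<ge> i + 1\<close> before
  it; conversely \<open>e\<^sub>i\<close> changes the last \<open>i + 1\<close>.
\<close>

lemma descending_f_op_iff:
  assumes "f_op i b = Some c"
  shows "descending c \<longleftrightarrow> descending b"
  using assms
proof (induction b arbitrary: c)
  case (Cons x b)
  show ?case
  proof (cases "phi_letter i x > eps i b")
    case True
    then have x: "x = i" and eps0: "eps i b = 0"
      by (auto simp: phi_letter_def split: if_splits)
    with Cons.prems have c: "c = Suc i # b"
      by (simp add: phi_letter_def f_letter_def)
    have "y \<le> i" if "descending b" "\<forall>y\<in>set b. y \<le> Suc i" "y \<in> set b" for y
    proof -
      have "Suc i \<notin> set b"
        using eps_descending[OF that(1), of i] eps0 by (simp add: count_list_0_iff)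
      then show ?thesis using that(2,3) by (metis le_SucE)
    qed
    then show ?thesis by (auto simp: x c le_SucI)
  next
    case False
    with Cons.prems obtain d where d: "f_op i b = Some d" "c = x # d" by auto
    have sets: "i \<in> set b" "Suc i \<in> set d" "set d \<subseteq> insert (Suc i) (set b)" "set b \<subseteq> insert i (set d)"
      using f_op_set[OF d(1)] by auto
    have "Suc i \<le> x" if b: "descending b" "\<forall>y\<in>set b. y \<le> x"
    proof (rule ccontr)
      assume "\<not> Suc i \<le> x"
      with b(2) sets(1) have x: "x = i" by (meson le_antisym not_less_eq_eq)
      then have "Suc i \<notin> set b" using b(2) by auto
      then have "eps i b = 0" using eps_descending[OF b(1), of i] by (simp add: count_list_0_iff)
      with False x show False by (simp add: phi_letter_def)
    qed
    then have "descending b \<Longrightarrow> (\<forall>y\<in>set d. y \<le> x) \<longleftrightarrow> (\<forall>y\<in>set b. y \<le> x)"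
      using sets by (smt (verit, best) Suc_leD insert_iff subset_iff)
    then show ?thesis
      using Cons.IH[OF d(1)] by (auto simp: d(2))
  qed
qed simp

lemma mirrored_descending_iff:
  assumes "mirrored i b c"
  shows "descending c \<longleftrightarrow> descending b"
proof -
  obtain k where "iter_op (f_op i) k b = Some c"
    using assms by (auto simp: mirrored_def)
  then show ?thesis
  proof (induction k arbitrary: c)
    case (Suc k)
    then obtain d where "iter_op (f_op i) k b = Some d" "f_op i d = Some c"
      by (auto simp: bind_eq_Some_conv)
    with Suc.IH descending_f_op_iff show ?case by metis
  qed simp
qed

lemma descending_crystal_refl:
  assumes "descending b"
  shows "descending (crystal_refl n i b)"
proof (cases "i \<in> {1..n}")
  case True
  from mirrored_crystal_refl[OF this, of b] show ?thesis
    using mirrored_descending_iff assms by blast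
qed (simp add: crystal_refl_outside assms)

lemma descending_eq:
  assumes "descending b" "descending c" "\<And>j. count_list b j = count_list c j"
  shows "b = c"
proof -
  have "mset b = mset c"
    using assms(3) by (intro multiset_eqI) (simp add: count_mset)
  then have "mset (rev b) = mset (rev c)" by simp
  moreover have "sorted (rev b)" "sorted (rev c)"
    using assms(1,2) by (simp_all add: sorted_wrt_rev)
  ultimately have "rev b = rev c"
    by (metis properties_for_sort)
  then show ?thesis by simp
qed

section \<open>Sorting words by symmetries of the reflections\<close>

text \<open>
  Maps along which an identity between products of crystal reflections can be transported from \<open>g b\<close>
  back to \<open>b\<close>.
\<close>

definition refl_symmetry :: "(nat list \<Rightarrow> nat list) \<Rightarrow> bool" where
  "refl_symmetry g \<longleftrightarrow> inj g \<and> (\<forall>b j. count_list (g b) j = count_list b j) \<and>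
    (\<forall>n i b. crystal_refl n i (g b) = g (crystal_refl n i b))"

lemma refl_symmetry_comp:
  "refl_symmetry g \<Longrightarrow> refl_symmetry h \<Longrightarrow> refl_symmetry (g \<circ> h)"
  unfolding refl_symmetry_def by (auto intro: inj_compose)

lemma refl_symmetry_id: "refl_symmetry id"
  by (simp add: refl_symmetry_def)

lemma refl_symmetry_knuth_swap_at: "refl_symmetry (knuth_swap_at p)"
  unfolding refl_symmetry_def
proof (intro conjI allI)
  show "inj (knuth_swap_at p)" by (metis injI knuth_swap_at_swap_at)
qed (simp_all add: count_knuth_swap_at crystal_refl_commute mirrored_knuth_swap_at)

lemma refl_symmetry_rotate1: "refl_symmetry rotate1"
  unfolding refl_symmetry_def
proof (intro conjI allI)
  show "inj (rotate1 :: nat list \<Rightarrow> nat list)"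
  proof (rule injI)
    fix b c :: "nat list"
    assume "rotate1 b = rotate1 c"
    then show "b = c" by (cases b; cases c) auto
  qed
  show "count_list (rotate1 b) j = count_list b j" for b :: "nat list" and j
    by (cases b) auto
qed (simp add: crystal_refl_commute mirrored_rotate1)

definition carried_to :: "nat list \<Rightarrow> nat list \<Rightarrow> bool" where
  "carried_to b c \<longleftrightarrow> (\<exists>g. refl_symmetry g \<and> g b = c)"

lemma carried_to_refl: "carried_to b b"
  unfolding carried_to_def using refl_symmetry_id by (intro exI[of _ id]) simp

lemma carried_to_trans: "carried_to b c \<Longrightarrow> carried_to c d \<Longrightarrow> carried_to b d"
  unfolding carried_to_def by (metis refl_symmetry_comp comp_apply)

lemma carried_to_knuth_swap_at: "carried_to b (knuth_swap_at p b)"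
  unfolding carried_to_def using refl_symmetry_knuth_swap_at by blast

lemma carried_to_last_to_front: "carried_to (b @ [x]) (x # b)"
proof -
  have pow: "refl_symmetry (rotate1 ^^ k)" for k
  proof (induction k)
    case 0
    show ?case unfolding funpow.simps(1) by (rule refl_symmetry_id)
  next
    case (Suc k)
    then show ?case unfolding funpow.simps(2) by (rule refl_symmetry_comp[OF refl_symmetry_rotate1])
  qed
  have "(rotate1 ^^ length b) (b @ [x]) = x # b"
    by (simp add: rotate_def[symmetric] rotate_append)
  with pow show ?thesis unfolding carried_to_def by blast
qed

lemma knuth_swap_at_append: "knuth_swap_at (length u) (u @ b) = u @ knuth_swap b"
  by (induction u) auto

lemma carried_to_knuth1:
  assumes "x < y" "y \<le> z"
  shows "carried_to (u @ x # z # y # v) (u @ z # x # y # v)"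
  using carried_to_knuth_swap_at[of "u @ x # z # y # v" "length u"] assms
  by (simp add: knuth_swap_at_append)

lemma carried_to_knuth2:
  assumes "x \<le> y" "y < z"
  shows "carried_to (u @ y # z # x # v) (u @ y # x # z # v)"
  using carried_to_knuth_swap_at[of "u @ y # z # x # v" "length u"] assms
  by (simp add: knuth_swap_at_append)

text \<open>
  The two halves of row insertion of \<open>x\<close> into a row \<open>B y A\<close>, where \<open>y\<close> is the last letter greater
  than \<open>x\<close>: first \<open>x\<close> passes the letters of \<open>B\<close>, then \<open>y\<close> passes the letters of \<open>A\<close>.
\<close>

lemma carried_to_pass_larger:
  assumes "descending (B @ [y])" "x < y"
  shows "carried_to (u @ x # B @ y # v) (u @ B @ x # y # v)"
  using assms
proof (induction B arbitrary: u)
  case (Cons b B)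
  define e where "e = hd (B @ [y])"
  obtain w where w: "B @ y # v = e # w" by (cases B) (auto simp: e_def)
  have "e \<le> b" "x < e"
    using Cons.prems by (cases B; force simp: e_def)+
  then have "carried_to (u @ x # b # e # w) (u @ b # x # e # w)"
    by (intro carried_to_knuth1)
  moreover have "carried_to ((u @ [b]) @ x # B @ y # v) ((u @ [b]) @ B @ x # y # v)"
    using Cons.prems by (intro Cons.IH) auto
  ultimately show ?case
    using carried_to_trans by (simp add: w)
qed (simp add: carried_to_refl)

lemma carried_to_pass_smaller:
  assumes "descending (x # A)" "x < y"
  shows "carried_to (u @ x # y # A @ v) (u @ x # A @ y # v)"
  using assms
proof (induction A arbitrary: u x)
  case (Cons a A)
  have "carried_to (u @ x # y # a # A @ v) (u @ x # a # y # A @ v)"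
    using Cons.prems by (intro carried_to_knuth2) auto
  moreover have "carried_to ((u @ [x]) @ a # y # A @ v) ((u @ [x]) @ a # A @ y # v)"
    using Cons.prems by (intro Cons.IH) auto
  ultimately show ?case
    using carried_to_trans by simp
qed (simp add: carried_to_refl)

lemma split_descending:
  assumes "descending R" "R \<noteq> []" "x < hd R"
  shows "\<exists>B y A. R = B @ y # A \<and> x < y \<and> (\<forall>a\<in>set A. a \<le> x)"
  using assms
proof (induction R)
  case (Cons r R)
  show ?case
  proof (cases "R \<noteq> [] \<and> x < hd R")
    case True
    with Cons obtain B y A where "R = B @ y # A" "x < y" "\<forall>a\<in>set A. a \<le> x"
      by auto
    then show ?thesis by (intro exI[of _ "r # B"] exI[of _ y] exI[of _ A]) simp
  next
    case False
    with Cons.prems have "\<forall>a\<in>set R. a \<le> x"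
      by (cases R) force+
    with Cons.prems show ?thesis by (intro exI[of _ "[]"] exI[of _ r] exI[of _ R]) simp
  qed
qed simp

text \<open>
  The letter \<open>x\<close> replaces a greater letter \<open>y\<close> of the row; the decrease of the sum makes the sorting
  procedure of \<open>carried_to_descending_append\<close> terminate.
\<close>

lemma carried_to_row_insertion:
  assumes "descending R" "R \<noteq> []" "x < hd R"
  shows "\<exists>R' y. descending R' \<and> sum_list R' < sum_list R \<and> carried_to (x # R @ v) (R' @ y # v)"
proof -
  obtain B y A where R: "R = B @ y # A" and xy: "x < y" and A: "\<forall>a\<in>set A. a \<le> x"
    using split_descending[OF assms] by blast
  have "carried_to ([] @ x # B @ y # A @ v) ([] @ B @ x # y # A @ v)"
    using assms(1) xy by (intro carried_to_pass_larger) (auto simp: R sorted_wrt_append)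
  moreover have "carried_to (B @ x # y # A @ v) (B @ x # A @ y # v)"
    using assms(1) xy A by (intro carried_to_pass_smaller) (auto simp: R sorted_wrt_append)
  ultimately have "carried_to (x # R @ v) ((B @ x # A) @ y # v)"
    using carried_to_trans by (simp add: R)
  moreover have "descending (B @ x # A)"
    using assms(1) xy A by (fastforce simp: R sorted_wrt_append)
  moreover have "sum_list (B @ x # A) < sum_list R"
    using xy by (simp add: R)
  ultimately show ?thesis by blast
qed

text \<open>
  The part \<open>u\<close> behind the row \<open>R\<close> serves as a queue.  Rotation brings its last letter \<open>x\<close> in front of
  \<open>R\<close>.  Either \<open>x\<close> extends the row, and the queue is shorter, or \<open>x\<close> is inserted and the bumped
  letter joins the queue, and the row keeps its length but has a smaller sum.
\<close>

lemma carried_to_descending_append: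
  assumes "descending R"
  shows "\<exists>c. descending c \<and> carried_to (R @ u) c"
  using assms
proof (induction "(length u, sum_list R)" arbitrary: R u rule: wf_induct_rule[OF wf_lex_prod[OF wf_less_than wf_less_than]])
  case (1 R u)
  show ?case
  proof (cases u rule: rev_cases)
    case Nil
    with 1(2) show ?thesis using carried_to_refl by (intro exI[of _ R]) simp
  next
    case (snoc u' x)
    have front: "carried_to (R @ u) (x # R @ u')"
      using carried_to_last_to_front[of "R @ u'" x] by (simp add: snoc)
    show ?thesis
    proof (cases "R \<noteq> [] \<and> x < hd R")
      case True
      then obtain R' y where R': "descending R'" "sum_list R' < sum_list R" "carried_to (x # R @ u') (R' @ y # u')"
        using carried_to_row_insertion[OF 1(2)] by blast
      have "\<exists>c. descending c \<and> carried_to (R' @ y # u') c"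
        using R' by (intro 1(1)) (auto simp: snoc)
      then show ?thesis using front R'(3) carried_to_trans by blast
    next
      case False
      with 1(2) have "descending (x # R)" by (cases R) force+
      then have "\<exists>c. descending c \<and> carried_to ((x # R) @ u') c"
        by (intro 1(1)) (auto simp: snoc)
      then show ?thesis using front carried_to_trans by force
    qed
  qed
qed

lemma carried_to_descending: "\<exists>c. descending c \<and> carried_to b c"
  using carried_to_descending_append[of "[]" b] by simp

lemma refl_symmetry_foldr:
  assumes "refl_symmetry g"
  shows "foldr (crystal_refl n) ks (g b) = g (foldr (crystal_refl n) ks b)"
  using assms by (induction ks) (simp_all add: refl_symmetry_def)

text \<open>
  For weakly decreasing \<open>b\<close> this is clear, as a weakly decreasing word is determined by its content.
  A symmetry that sorts \<open>b\<close> transports the statement to arbitrary words.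
\<close>

lemma foldr_crystal_refl_determined_by_content:
  assumes "\<And>j. count_list (foldr (crystal_refl n) ks b) j = count_list (foldr (crystal_refl n) ls b) j"
  shows "foldr (crystal_refl n) ks b = foldr (crystal_refl n) ls b"
proof -
  obtain g where g: "refl_symmetry g" "descending (g b)"
    using carried_to_descending[of b] by (auto simp: carried_to_def)
  have desc: "descending (foldr (crystal_refl n) ms (g b))" for ms
    by (induction ms) (simp_all add: g(2) descending_crystal_refl)
  have "foldr (crystal_refl n) ks (g b) = foldr (crystal_refl n) ls (g b)"
    using assms g(1) by (intro descending_eq desc) (simp add: refl_symmetry_foldr refl_symmetry_def)
  then show ?thesis
    using g(1) by (simp add: refl_symmetry_foldr refl_symmetry_def inj_eq)
qed

section \<open>The Weyl group action\<close>

lemma weyl_product_Nil [simp]: "weyl_product [] = id"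
  and weyl_product_Cons [simp]: "weyl_product (i # ks) = simple_refl i \<circ> weyl_product ks"
  by (simp_all add: weyl_product_def)

lemma weyl_product_append: "weyl_product (ks @ ls) = weyl_product ks \<circ> weyl_product ls"
  by (induction ks) (simp_all add: comp_assoc)

lemma weyl_product_transpose:
  assumes "1 \<le> a" "a < b" "b \<le> Suc m"
  shows "\<exists>ks. set ks \<subseteq> {1..m} \<and> weyl_product ks = transpose a b"
  using assms(2,3)
proof (induction b rule: less_induct)
  case (less b)
  then obtain c where b: "b = Suc c" by (cases b) auto
  show ?case
  proof (cases "a = c")
    case True
    then show ?thesis using assms(1) less.prems
      by (intro exI[of _ "[c]"]) (simp add: b simple_refl_def)
  next
    case False
    then obtain ks where ks: "set ks \<subseteq> {1..m}" "weyl_product ks = transpose a c"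
      using less.IH[of c] less.prems b by auto
    have "transpose a b = transpose c b \<circ> transpose a c \<circ> transpose c b"
      using False less.prems b by (auto simp: fun_eq_iff transpose_def)
    then have "weyl_product (c # ks @ [c]) = transpose a b"
      by (simp add: weyl_product_append ks(2) simple_refl_def b comp_assoc)
    moreover have "set (c # ks @ [c]) \<subseteq> {1..m}"
      using ks(1) less.prems assms(1) b False by auto
    ultimately show ?thesis by blast
  qed
qed

lemma weyl_product_exists:
  assumes "w permutes {1..Suc m}"
  shows "\<exists>ks. set ks \<subseteq> {1..m} \<and> weyl_product ks = w"
  using assms finite_atLeastAtMost[of 1 "Suc m"]
proof (induction rule: permutes_induct)
  case id
  show ?case by (intro exI[of _ "[]"]) simp
next
  case (swap a b w)
  obtain ls where ls: "set ls \<subseteq> {1..m}" "weyl_product ls = transpose a b"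
    using weyl_product_transpose[of a b m] weyl_product_transpose[of b a m] swap(1-3)
    by (cases "a < b") (auto simp: transpose_commute)
  obtain ks where ks: "set ks \<subseteq> {1..m}" "weyl_product ks = w"
    using swap by blast
  show ?case
    using ls ks by (intro exI[of _ "ls @ ks"]) (simp add: weyl_product_append)
qed

lemma count_foldr_crystal_refl:
  "set ks \<subseteq> {1..n} \<Longrightarrow>
    count_list (foldr (crystal_refl n) ks b) (weyl_product ks j) = count_list b j"
  by (induction ks) (simp_all add: count_crystal_refl)

lemma permutes_weyl_product:
  "set ks \<subseteq> {1..n} \<Longrightarrow> weyl_product ks permutes {1..n+1}"
proof (induction ks)
  case (Cons i ks)
  then have "simple_refl i permutes {1..n+1}"
    unfolding simple_refl_def by (intro permutes_swap_id) auto
  moreover have "weyl_product ks permutes {1..n+1}" using Cons by simp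
  ultimately show ?case unfolding weyl_product_Cons by (rule permutes_compose[rotated])
qed (simp add: permutes_id)

lemma weyl_act_eq_foldr:
  assumes "w \<in> weyl_group n"
  obtains ks where "set ks \<subseteq> {1..n}" "weyl_product ks = w"
    "\<And>b. weyl_act n w b = foldr (crystal_refl n) ks b"
proof -
  define ks where "ks = (SOME ks. set ks \<subseteq> {1..n} \<and> weyl_product ks = w)"
  have "\<exists>ks. set ks \<subseteq> {1..n} \<and> weyl_product ks = w"
    using weyl_product_exists[of w n] assms by (simp add: weyl_group_def)
  from someI_ex[OF this] have "set ks \<subseteq> {1..n}" "weyl_product ks = w"
    unfolding ks_def by auto
  then show ?thesis
    by (rule that) (simp add: weyl_act_def ks_def)
qed

lemma count_weyl_act:
  assumes "w \<in> weyl_group n"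
  shows "count_list (weyl_act n w b) (w j) = count_list b j"
  using weyl_act_eq_foldr[OF assms] count_foldr_crystal_refl by metis

text \<open>
  The hypothesis says that \<open>w\<close> and the product of \<open>ks\<close> permute the content of \<open>b\<close> in the same way.
  This covers both the independence of the expression for \<open>w\<close> and the triviality of the stabilizer of
  the content.
\<close>

lemma weyl_act_eqI:
  assumes "w \<in> weyl_group n" "set ks \<subseteq> {1..n}"
    and "\<And>j. count_list b j = count_list b (inv (weyl_product ks) (w j))"
  shows "weyl_act n w b = foldr (crystal_refl n) ks b"
proof -
  obtain ls where ls: "set ls \<subseteq> {1..n}" "weyl_product ls = w"
      "\<And>b. weyl_act n w b = foldr (crystal_refl n) ls b"
    using weyl_act_eq_foldr[OF assms(1)] by metis
  have w: "w permutes {1..n+1}" using assms(1) by (simp add: weyl_group_def)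
  have "count_list (foldr (crystal_refl n) ls b) j = count_list (foldr (crystal_refl n) ks b) j" for j
  proof -
    obtain k where k: "w k = j" using permutes_surj[OF w] by (metis surjD)
    have "weyl_product ks (inv (weyl_product ks) j) = j"
      using permutes_weyl_product[OF assms(2)] by (simp add: permutes_inverses)
    then have "count_list (foldr (crystal_refl n) ks b) j = count_list b (inv (weyl_product ks) j)"
      using count_foldr_crystal_refl[OF assms(2)] by metis
    moreover have "count_list (foldr (crystal_refl n) ls b) j = count_list b k"
      using count_foldr_crystal_refl[OF ls(1), of b k] ls(2) k by simp
    ultimately show ?thesis using assms(3)[of k] k by simp
  qed
  then show ?thesis
    unfolding ls(3) by (rule foldr_crystal_refl_determined_by_content)
qed

lemma weyl_act_weyl_product:
  assumes "set ks \<subseteq> {1..n}"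
  shows "weyl_act n (weyl_product ks) b = foldr (crystal_refl n) ks b"
  using permutes_weyl_product[OF assms] assms
  by (intro weyl_act_eqI) (auto simp: weyl_group_def permutes_inverses)

lemma weyl_act_comp:
  assumes "v \<in> weyl_group n" "w \<in> weyl_group n"
  shows "weyl_act n (v \<circ> w) b = weyl_act n v (weyl_act n w b)"
proof -
  obtain ks where ks: "set ks \<subseteq> {1..n}" "weyl_product ks = v"
      "\<And>b. weyl_act n v b = foldr (crystal_refl n) ks b"
    using weyl_act_eq_foldr[OF assms(1)] by metis
  obtain ls where ls: "set ls \<subseteq> {1..n}" "weyl_product ls = w"
      "\<And>b. weyl_act n w b = foldr (crystal_refl n) ls b"
    using weyl_act_eq_foldr[OF assms(2)] by metis
  show ?thesis
    using weyl_act_weyl_product[of "ks @ ls" n b] ks ls by (simp add: weyl_product_append)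
qed

lemma weyl_act_stabilizer:
  assumes "w \<in> weyl_group n" "\<And>j. count_list b (w j) = count_list b j"
  shows "weyl_act n w b = b"
  using weyl_act_eqI[of w n "[]" b] assms by (simp add: inv_id[unfolded id_def])

lemma weyl_group_closed:
  shows "id \<in> weyl_group n"
    and "v \<in> weyl_group n \<Longrightarrow> w \<in> weyl_group n \<Longrightarrow> v \<circ> w \<in> weyl_group n"
    and "w \<in> weyl_group n \<Longrightarrow> inv w \<in> weyl_group n"
  by (simp_all add: weyl_group_def permutes_id permutes_compose permutes_inv)

lemma weyl_act_inv:
  assumes "w \<in> weyl_group n"
  shows "weyl_act n (inv w) (weyl_act n w b) = b" and "weyl_act n w (weyl_act n (inv w) b) = b"
proof -
  have w: "w permutes {1..n+1}" using assms by (simp add: weyl_group_def)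
  have id: "weyl_act n id b = b"
    using weyl_act_stabilizer weyl_group_closed(1) by simp
  show "weyl_act n (inv w) (weyl_act n w b) = b" "weyl_act n w (weyl_act n (inv w) b) = b"
    using id assms weyl_act_comp[of "inv w" n w b] weyl_act_comp[of w n "inv w" b]
    by (simp_all add: weyl_group_closed permutes_inv_o[OF w])
qed

lemma iter_op_in_crystal:
  assumes "b \<in> crystal n \<Lambda>" "i \<in> {1..n}"
  shows "iter_op (f_op i) k b = Some c \<Longrightarrow> c \<in> crystal n \<Lambda>"
    and "iter_op (e_op i) k b = Some c \<Longrightarrow> c \<in> crystal n \<Lambda>"
  by (induction k arbitrary: c)
    (auto simp: assms bind_eq_Some_conv intro: crystal.f_step[OF _ assms(2)] crystal.e_step[OF _ assms(2)])

lemma crystal_refl_in_crystal: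
  assumes "b \<in> crystal n \<Lambda>" "i \<in> {1..n}"
  shows "crystal_refl n i b \<in> crystal n \<Lambda>"
  using mirrored_crystal_refl[OF assms(2), of b] iter_op_in_crystal[OF assms]
  by (auto simp: mirrored_def iter_e_op_iff)

lemma weyl_act_in_crystal:
  assumes "w \<in> weyl_group n" "b \<in> crystal n \<Lambda>"
  shows "weyl_act n w b \<in> crystal n \<Lambda>"
proof -
  obtain ks where ks: "set ks \<subseteq> {1..n}" and act: "\<And>b. weyl_act n w b = foldr (crystal_refl n) ks b"
    using weyl_act_eq_foldr[OF assms(1)] by metis
  from ks have "foldr (crystal_refl n) ks b \<in> crystal n \<Lambda>"
    by (induction ks) (auto simp: assms(2) crystal_refl_in_crystal)
  then show ?thesis by (simp add: act)
qed

section \<open>Operators of distant simple roots\<close>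

lemma eps_f_op_far:
  assumes "Suc i < j \<or> Suc j < i" "f_op i b = Some c"
  shows "eps j c = eps j b"
  using assms(2)
proof (induction b arbitrary: c)
  case (Cons x b)
  then show ?case
    using assms(1) by (auto simp: f_letter_def eps_letter_def phi_letter_def split: if_splits)
qed simp

lemma f_op_Cons:
  "f_op i (x # b) =
    (if x = i \<and> eps i b = 0 then Some (Suc i # b) else map_option ((#) x) (f_op i b))"
  by (simp add: phi_letter_def f_letter_def)

lemma f_op_far_commute:
  assumes "Suc i < j"
  shows "Option.bind (f_op i b) (f_op j) = Option.bind (f_op j b) (f_op i)"
proof (induction b)
  case (Cons x b)
  have eps: "f_op i b = Some c \<Longrightarrow> eps j c = eps j b" "f_op j b = Some c \<Longrightarrow> eps i c = eps i b" for c
    using eps_f_op_far assms by blast+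
  have ij: "i \<noteq> j" "Suc i \<noteq> j" "Suc j \<noteq> i" using assms by simp_all
  consider "x = i" "eps i b = 0" | "x = j" "eps j b = 0"
    | "\<not> (x = i \<and> eps i b = 0)" "\<not> (x = j \<and> eps j b = 0)" by metis
  then show ?case
  proof cases
    case 1
    then show ?thesis using ij eps by (cases "f_op j b") (simp_all add: f_op_Cons del: f_op.simps)
  next
    case 2
    then show ?thesis using ij eps by (cases "f_op i b") (simp_all add: f_op_Cons del: f_op.simps)
  next
    case 3
    have "Option.bind (f_op i (x # b)) (f_op j) = map_option ((#) x) (Option.bind (f_op i b) (f_op j))"
      unfolding f_op_Cons[of i] if_not_P[OF 3(1)] using eps 3(2)
      by (cases "f_op i b") (auto simp: f_op_Cons simp del: f_op.simps)
    moreover have "Option.bind (f_op j (x # b)) (f_op i) = map_option ((#) x) (Option.bind (f_op j b) (f_op i))"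
      unfolding f_op_Cons[of j] if_not_P[OF 3(2)] using eps 3(1)
      by (cases "f_op j b") (auto simp: f_op_Cons simp del: f_op.simps)
    ultimately show ?thesis by (simp only: Cons.IH)
  qed
qed simp

lemma phi_f_op_far:
  assumes "Suc i < j" "f_op i b = Some c"
  shows "phi j c = phi j b"
proof -
  have "eps j c = eps j b" using eps_f_op_far assms by blast
  moreover have "count_list c j = count_list b j" "count_list c (Suc j) = count_list b (Suc j)"
    using count_f_op[OF assms(2), of j] count_f_op[OF assms(2), of "Suc j"] assms(1) by simp_all
  ultimately show ?thesis
    using phi_minus_eps[of j b] phi_minus_eps[of j c] by simp
qed

lemma phi_mirrored_far:
  assumes "Suc i < j" "mirrored i b c"
  shows "phi j c = phi j b"
proof -
  obtain k where "iter_op (f_op i) k b = Some c"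
    using assms(2) by (auto simp: mirrored_def)
  then show ?thesis
    by (induction k arbitrary: c) (auto simp: bind_eq_Some_conv phi_f_op_far[OF assms(1)])
qed

lemma mirrored_f_op_far:
  assumes far: "Suc i < j" and f: "f_op j b = Some c" "f_op j b' = Some c'" and m: "mirrored i b b'"
  shows "mirrored i c c'"
proof -
  obtain k where k: "iter_op (f_op i) k b = Some b'"
      "int k = int (count_list b i) - int (count_list b (Suc i))"
    using m by (auto simp: mirrored_def)
  have "Option.bind (iter_op (f_op i) k b) (f_op j) = Option.bind (f_op j b) (iter_op (f_op i) k)" for k
  proof (induction k)
    case (Suc k)
    have "Option.bind (iter_op (f_op i) (Suc k) b) (f_op j)
        = Option.bind (iter_op (f_op i) k b) (\<lambda>d. Option.bind (f_op j d) (f_op i))"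
      by (simp add: bind_assoc f_op_far_commute[OF far])
    also have "\<dots> = Option.bind (f_op j b) (iter_op (f_op i) (Suc k))"
      using arg_cong[OF Suc, of "\<lambda>x. Option.bind x (f_op i)"] by (cases "f_op j b") (simp_all add: bind_assoc)
    finally show ?case .
  qed simp
  from this[of k] have "iter_op (f_op i) k c = Some c'"
    using f k(1) by simp
  moreover have "int k = int (count_list c i) - int (count_list c (Suc i))"
    using k(2) count_f_op[OF f(1), of i] count_f_op[OF f(1), of "Suc i"] far by simp
  ultimately show ?thesis by (auto simp: mirrored_def)
qed

lemma f_op_crystal_refl_far:
  assumes far: "Suc i < j" and i: "i \<in> {1..n}" and f: "f_op j b = Some c"
  shows "f_op j (crystal_refl n i b) = Some (crystal_refl n i c)"
proof -
  define b' where "b' = crystal_refl n i b"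
  have m: "mirrored i b b' \<or> mirrored i b' b"
    unfolding b'_def by (rule mirrored_crystal_refl[OF i])
  then have "phi j b' = phi j b"
    using phi_mirrored_far[OF far] by metis
  then obtain c' where c': "f_op j b' = Some c'"
    using f f_op_None_iff[of j b] f_op_None_iff[of j b'] by auto
  have "crystal_refl n i c = c'"
    using m mirrored_f_op_far[OF far f c'] mirrored_f_op_far[OF far c' f]
      crystal_refl_of_mirrored[OF i] by blast
  then show ?thesis using c' by (simp add: b'_def)
qed

text \<open>
  A permutation that fixes \<open>n\<close> and \<open>n + 1\<close> is a product of \<open>s\<^sub>1, \<dots>, s\<^bsub>n-2\<^esub>\<close>.  For \<open>n \<le> 2\<close> it is the
  identity; there truncated subtraction turns \<open>{1..n - 2}\<close> into the empty set.
\<close>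

lemma f_op_weyl_act_stabilizer:
  assumes v: "v \<in> weyl_group n" "v n = n" "v (Suc n) = Suc n" and f: "f_op n b = Some c"
  shows "f_op n (weyl_act n v b) = Some (weyl_act n v c)"
proof -
  have "v permutes {1..Suc (n - 2)}"
  proof (rule permutes_superset)
    show "v permutes {1..n+1}" using v(1) by (simp add: weyl_group_def)
    fix x assume "x \<in> {1..n+1} - {1..Suc (n - 2)}"
    then have "x = n \<or> x = Suc n" by auto
    then show "v x = x" using v(2,3) by blast
  qed
  then obtain ks where ks: "set ks \<subseteq> {1..n - 2}" "weyl_product ks = v"
    using weyl_product_exists by blast
  have "{1..n - 2} \<subseteq> {1..n}" by auto
  with ks(1) have ks': "set ks \<subseteq> {1..n}" by (rule subset_trans)
  have "f_op n (foldr (crystal_refl n) ks b) = Some (foldr (crystal_refl n) ks c)"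
    using ks(1)
  proof (induction ks)
    case (Cons i ks)
    then have "Suc i < n" "i \<in> {1..n}" by auto
    from f_op_crystal_refl_far[OF this] Cons show ?case by simp
  qed (simp add: f)
  then show ?thesis
    using weyl_act_weyl_product[OF ks'] ks(2) by simp
qed

section \<open>Dominant representatives\<close>

lemma antitone_rearrangement_unique:
  fixes a :: "nat \<Rightarrow> nat"
  assumes p: "p permutes {1..m}"
    and a: "\<And>j k. 1 \<le> j \<Longrightarrow> j \<le> k \<Longrightarrow> k \<le> m \<Longrightarrow> a k \<le> a j"
    and ap: "\<And>j k. 1 \<le> j \<Longrightarrow> j \<le> k \<Longrightarrow> k \<le> m \<Longrightarrow> a (p k) \<le> a (p j)"
  shows "a (p j) = a j"
proof -
  define xs where "xs = [1..<Suc m]"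
  have xs: "mset xs = mset_set {1..m}"
    by (simp only: xs_def mset_upt atLeastLessThanSuc_atLeastAtMost)
  have "mset (map (a \<circ> p) xs) = image_mset a (image_mset p (mset_set {1..m}))"
    by (simp add: xs flip: image_mset.compositionality)
  also have "\<dots> = mset (map a xs)"
    using permutes_inj_on[OF p] permutes_image[OF p] by (simp add: image_mset_mset_set xs)
  finally have eq: "mset (map (a \<circ> p) xs) = mset (map a xs)" .
  have desc: "descending (map b xs)"
    if "\<And>j k. 1 \<le> j \<Longrightarrow> j \<le> k \<Longrightarrow> k \<le> m \<Longrightarrow> b k \<le> b j" for b
    unfolding sorted_wrt_map
    by (rule sorted_wrt_mono_rel[OF _ sorted_wrt_upt[of 1 "Suc m", folded xs_def]])
      (auto simp: xs_def intro!: that)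
  have "map (a \<circ> p) xs = map a xs"
    using eq a ap by (intro descending_eq desc) (simp_all add: count_mset[symmetric])
  then have "\<forall>j\<in>{1..m}. a (p j) = a j"
    by (auto simp: xs_def)
  then show ?thesis
    using permutes_not_in[OF p, of j] by metis
qed

text \<open>
  The inverse of \<open>w\<close> lists \<open>{1..m}\<close> by decreasing values of \<open>g\<close>.
\<close>

lemma sorting_permutation_exists:
  fixes g :: "nat \<Rightarrow> int"
  obtains w where "w permutes {1..m}"
    and "\<And>j k. j \<in> {1..m} \<Longrightarrow> k \<in> {1..m} \<Longrightarrow> w j \<le> w k \<Longrightarrow> g k \<le> g j"
proof -
  define xs where "xs = sort_key (\<lambda>j. - g j) [1..<Suc m]"
  define p where "p = (\<lambda>k. if k \<in> {1..m} then xs ! (k - 1) else k)"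
  have xs: "distinct xs" "set xs = {1..m}" "length xs = m"
    by (auto simp: xs_def simp del: upt_Suc)
  have "bij_betw (nth xs) {..<m} {1..m}"
    using bij_betw_nth[OF xs(1), of "{..<m}" "{1..m}"] xs by simp
  moreover have "bij_betw (\<lambda>k. k - 1) {1..m} {..<m}"
    by (rule bij_betw_byWitness[where f' = Suc]) auto
  ultimately have "bij_betw (nth xs \<circ> (\<lambda>k. k - 1)) {1..m} {1..m}"
    using bij_betw_trans by blast
  then have "bij_betw p {1..m} {1..m}"
    by (rule bij_betw_cong[THEN iffD1, rotated]) (simp add: p_def)
  then have p: "p permutes {1..m}"
    by (rule bij_imp_permutes) (auto simp: p_def)
  have mono: "g (p k) \<le> g (p j)" if "1 \<le> j" "j \<le> k" "k \<le> m" for j k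
  proof -
    have "sorted (map (\<lambda>j. - g j) xs)" by (simp add: xs_def)
    from sorted_nth_mono[OF this, of "j - 1" "k - 1"] show ?thesis
      using that xs(3) by (simp add: p_def)
  qed
  show ?thesis
  proof (rule that)
    show "inv p permutes {1..m}" by (rule permutes_inv[OF p])
    fix j k assume jk: "j \<in> {1..m}" "k \<in> {1..m}" "inv p j \<le> inv p k"
    then have "inv p j \<in> {1..m}" "inv p k \<in> {1..m}"
      using permutes_in_image[OF permutes_inv[OF p]] by blast+
    then show "g k \<le> g j"
      using mono[of "inv p j" "inv p k"] jk(3) permutes_inverses(1)[OF p] by simp
  qed
qed

lemma dominant_iff_antitone:
  "wt n b \<in> dominant_weights n \<longleftrightarrow>
    (\<forall>j k. 1 \<le> j \<and> j \<le> k \<and> k \<le> n + 1 \<longrightarrow> count_list b k \<le> count_list b j)"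
proof
  assume dom: "wt n b \<in> dominant_weights n"
  have step: "count_list b (Suc i) \<le> count_list b i" if "i \<in> {1..n}" for i
  proof -
    have "0 \<le> wt n b i" using dom that by (simp add: dominant_weights_def)
    then show ?thesis using that by (simp add: wt_def)
  qed
  show "\<forall>j k. 1 \<le> j \<and> j \<le> k \<and> k \<le> n + 1 \<longrightarrow> count_list b k \<le> count_list b j"
  proof (intro allI impI, elim conjE)
    fix j k :: nat assume "1 \<le> j" "j \<le> k" "k \<le> n + 1"
    from this(2,3) show "count_list b k \<le> count_list b j"
    proof (induction k rule: dec_induct)
      case (step k)
      then show ?case
        using \<open>1 \<le> j\<close> \<open>\<And>i. i \<in> {1..n} \<Longrightarrow> count_list b (Suc i) \<le> count_list b i\<close>[of k] by simp
    qed simp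
  qed
qed (auto simp: dominant_weights_def weight_lattice_def wt_def)

lemma weyl_act_dominantI:
  assumes w: "w \<in> weyl_group n"
    and sort: "\<And>j k. j \<in> {1..n+1} \<Longrightarrow> k \<in> {1..n+1} \<Longrightarrow> w j \<le> w k \<Longrightarrow> count_list b k \<le> count_list b j"
  shows "wt n (weyl_act n w b) \<in> dominant_weights n"
  unfolding dominant_iff_antitone
proof (intro allI impI, elim conjE)
  fix j k :: nat assume jk: "1 \<le> j" "j \<le> k" "k \<le> n + 1"
  have p: "w permutes {1..n+1}" using w by (simp add: weyl_group_def)
  have "inv w j \<in> {1..n+1}" "inv w k \<in> {1..n+1}"
    using jk permutes_in_image[OF permutes_inv[OF p]] by simp_all
  then show "count_list (weyl_act n w b) k \<le> count_list (weyl_act n w b) j"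
    using sort[of "inv w j" "inv w k"] jk(2) permutes_inverses(1)[OF p]
      count_weyl_act[OF w, of b "inv w j"] count_weyl_act[OF w, of b "inv w k"] by simp
qed

text \<open>
  The contents of \<open>b\<close> and \<open>w b\<close> are weakly decreasing rearrangements of each other, hence equal, so
  \<open>w\<close> stabilizes the content of \<open>b\<close>.
\<close>

lemma weyl_act_dominant_fixed:
  assumes w: "w \<in> weyl_group n"
    and dom: "wt n b \<in> dominant_weights n" "wt n (weyl_act n w b) \<in> dominant_weights n"
  shows "weyl_act n w b = b"
proof -
  have p: "w permutes {1..n+1}" using w by (simp add: weyl_group_def)
  have inv: "count_list (weyl_act n w b) j = count_list b (inv w j)" for j
    using count_weyl_act[OF w, of b "inv w j"] permutes_inverses(1)[OF p] by simp
  have "count_list b (inv w j) = count_list b j" for j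
    using dom unfolding dominant_iff_antitone inv
    by (intro antitone_rearrangement_unique[OF permutes_inv[OF p]]) auto
  from this[of "w j" for j] show ?thesis
    using w permutes_inverses(2)[OF p] by (intro weyl_act_stabilizer) simp_all
qed

lemma dominant_rep_eqI:
  assumes w: "w \<in> weyl_group n" and dom: "wt n (weyl_act n w b) \<in> dominant_weights n"
  shows "dominant_rep n b = weyl_act n w b"
  unfolding dominant_rep_def
proof (rule the_equality)
  fix c assume "(\<exists>v\<in>weyl_group n. c = weyl_act n v b) \<and> wt n c \<in> dominant_weights n"
  then obtain v where v: "v \<in> weyl_group n" "c = weyl_act n v b" "wt n c \<in> dominant_weights n"
    by blast
  have "weyl_act n (v \<circ> inv w) (weyl_act n w b) = c"
    using v w by (simp add: weyl_act_comp weyl_group_closed weyl_act_inv)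
  then show "c = weyl_act n w b"
    using weyl_act_dominant_fixed[of "v \<circ> inv w" n "weyl_act n w b"] v w dom
    by (simp add: weyl_group_closed)
qed (use assms in blast)

lemma dominant_rep_exists:
  obtains w where "w \<in> weyl_group n" "dominant_rep n b = weyl_act n w b"
    "wt n (dominant_rep n b) \<in> dominant_weights n"
proof -
  obtain w where w: "w permutes {1..n+1}"
      "\<And>j k. j \<in> {1..n+1} \<Longrightarrow> k \<in> {1..n+1} \<Longrightarrow> w j \<le> w k \<Longrightarrow>
        int (count_list b k) \<le> int (count_list b j)"
    using sorting_permutation_exists[of "n + 1" "\<lambda>j. int (count_list b j)"] by blast
  have "w \<in> weyl_group n" using w(1) by (simp add: weyl_group_def)
  moreover from this have "wt n (weyl_act n w b) \<in> dominant_weights n"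
    using w(2) by (intro weyl_act_dominantI) auto
  ultimately show ?thesis
    using that[of w] dominant_rep_eqI by simp
qed

lemma dominant_rep_weyl_act:
  assumes "w \<in> weyl_group n"
  shows "dominant_rep n (weyl_act n w b) = dominant_rep n b"
proof -
  obtain v where v: "v \<in> weyl_group n" "dominant_rep n (weyl_act n w b) = weyl_act n v (weyl_act n w b)"
    "wt n (dominant_rep n (weyl_act n w b)) \<in> dominant_weights n"
    using dominant_rep_exists by metis
  then show ?thesis
    using dominant_rep_eqI[of "v \<circ> w" n b] assms by (simp add: weyl_group_closed weyl_act_comp)
qed

lemma dominant_rep_in_Bplus_vertices:
  assumes "b \<in> crystal n \<Lambda>"
  shows "dominant_rep n b \<in> Bplus_vertices n \<Lambda>"
  using dominant_rep_exists[of n b] weyl_act_in_crystal[OF _ assms]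
  by (metis (mono_tags, lifting) Bplus_vertices_def mem_Collect_eq)

section \<open>Root operators\<close>

text \<open>
  The element \<open>u\<close> chosen in the definition of the operator differs from \<open>w\<close> by an element of the
  stabilizer of \<open>\<alpha>\<^sub>n\<close>, and this commutes with \<open>f\<^sub>n\<close>.
\<close>

lemma f_root_weyl_act:
  assumes w: "w \<in> weyl_group n" and f: "f_op n b = Some c"
  shows "f_root n (w n, w (Suc n)) (weyl_act n w b) = Some (weyl_act n w c)"
proof -
  define u where "u = (SOME u. u \<in> weyl_group n \<and> root_act u (simple_root n) = (w n, w (Suc n)))"
  have "w \<in> weyl_group n \<and> root_act w (simple_root n) = (w n, w (Suc n))"
    using w by (simp add: root_act_def simple_root_def)
  from someI[of "\<lambda>u. u \<in> weyl_group n \<and> root_act u (simple_root n) = (w n, w (Suc n))", OF this]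
  have u: "u \<in> weyl_group n" "u n = w n" "u (Suc n) = w (Suc n)"
    unfolding u_def[symmetric] by (auto simp: root_act_def simple_root_def)
  define v where "v = inv u \<circ> w"
  have v: "v \<in> weyl_group n" using u w by (simp add: v_def weyl_group_closed)
  have inj: "inv u (u j) = j" for j
    using u(1) permutes_inverses(2) by (auto simp: weyl_group_def)
  have "v n = n" "v (Suc n) = Suc n"
    by (simp_all add: v_def u(2,3)[symmetric] inj)
  then have "f_op n (weyl_act n v b) = Some (weyl_act n v c)"
    using f_op_weyl_act_stabilizer[OF v _ _ f] by blast
  moreover have "weyl_act n v d = weyl_act n (inv u) (weyl_act n w d)" for d
    using u w by (simp add: v_def weyl_act_comp weyl_group_closed)
  ultimately show ?thesis
    using u(1) by (simp add: f_root_def u_def[symmetric] weyl_act_inv)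
qed

lemma weyl_group_transitive_on_roots:
  assumes "n \<ge> 1" "\<alpha> \<in> positive_roots n"
  shows "\<exists>w\<in>weyl_group n. root_act w (simple_root n) = \<alpha>"
proof -
  obtain i j where \<alpha>: "\<alpha> = (i, j)" "1 \<le> i" "i < j" "j \<le> n + 1"
    using assms(2) by (auto simp: positive_roots_def)
  define k where "k = transpose n i j"
  define w where "w = transpose n i \<circ> transpose (Suc n) k"
  have k: "k \<noteq> n" "k \<in> {1..n+1}" using \<alpha> assms(1) by (auto simp: k_def transpose_def)
  have "transpose n i permutes {1..n+1}" "transpose (Suc n) k permutes {1..n+1}"
    using \<alpha> assms(1) k by (auto intro!: permutes_swap_id)
  then have "w permutes {1..n+1}" unfolding w_def by (rule permutes_compose[rotated])
  moreover have "w n = i" "w (Suc n) = j"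
    using k(1) by (simp_all add: w_def) (simp add: k_def)
  ultimately show ?thesis
    by (intro bexI[of _ w]) (simp_all add: \<alpha>(1) root_act_def simple_root_def weyl_group_def)
qed

text \<open>
  Let \<open>w\<close> sort the letters by the sum \<open>B + C\<close> of their multiplicities in \<open>b\<close> and \<open>c\<close>.  As \<open>C\<close> differs
  from \<open>B\<close> by \<open>-1\<close> at \<open>n\<close> and \<open>+1\<close> at \<open>n + 1\<close>, the sum could be ordered differently from \<open>B\<close> or \<open>C\<close>
  only at the pair \<open>n, n + 1\<close>, where the assumption on the weight leaves enough room.  For the same
  reason \<open>n\<close> is sorted before \<open>n + 1\<close>, so that \<open>w \<alpha>\<^sub>n\<close> is positive.
\<close>

lemma Bplus_edge_of_f_op:
  assumes n: "n \<ge> 1" and b: "b \<in> crystal n \<Lambda>" and f: "f_op n b = Some c" and wt: "wt n b n \<ge> 2"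
  shows "(dominant_rep n c, dominant_rep n b) \<in> Bplus_edges n \<Lambda>"
proof -
  define B C where "B = (\<lambda>j. int (count_list b j))" and "C = (\<lambda>j. int (count_list c j))"
  have C: "C j = B j - (if j = n then 1 else 0) + (if j = Suc n then 1 else 0)" for j
    unfolding B_def C_def by (rule count_f_op[OF f])
  have gap: "B (Suc n) + 2 \<le> B n" using wt n by (simp add: wt_def B_def)
  obtain w where p: "w permutes {1..n+1}"
    and sort: "\<And>j k. j \<in> {1..n+1} \<Longrightarrow> k \<in> {1..n+1} \<Longrightarrow> w j \<le> w k \<Longrightarrow> B k + C k \<le> B j + C j"
    using sorting_permutation_exists[of "n + 1" "\<lambda>j. B j + C j"] by blast
  have w: "w \<in> weyl_group n" using p by (simp add: weyl_group_def)
  have "B k \<le> B j \<and> C k \<le> C j" if "B k + C k \<le> B j + C j" for j k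
    using that gap by (auto simp: C split: if_splits)
  with sort have "wt n (weyl_act n w b) \<in> dominant_weights n" "wt n (weyl_act n w c) \<in> dominant_weights n"
    by (auto intro!: weyl_act_dominantI[OF w] simp: B_def C_def)
  then have rep: "dominant_rep n b = weyl_act n w b" "dominant_rep n c = weyl_act n w c"
    using dominant_rep_eqI[OF w] by blast+
  have "\<not> w (Suc n) \<le> w n"
    using sort[of "Suc n" n] n gap by (auto simp: C)
  then have "(w n, w (Suc n)) \<in> positive_roots n"
    using permutes_in_image[OF p, of n] permutes_in_image[OF p, of "Suc n"] n
    by (auto simp: positive_roots_def)
  moreover have "c \<in> crystal n \<Lambda>" using crystal.f_step[OF b _ f] n by simp
  ultimately show ?thesis
    using f_root_weyl_act[OF w f] dominant_rep_in_Bplus_vertices b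
    unfolding Bplus_edges_def rep by (auto simp flip: rep)
qed

section \<open>Connected components\<close>

text \<open>
  The relation of which \<open>connected_components\<close> is the set of classes.
\<close>

definition connectivity :: "'a set \<Rightarrow> ('a \<times> 'a) set \<Rightarrow> ('a \<times> 'a) set" where
  "connectivity V E =
    {(x, y). x \<in> V \<and> y \<in> V \<and> (x, y) \<in> ((E \<inter> V \<times> V) \<union> (E \<inter> V \<times> V)\<inverse>)\<^sup>*}"

lemma connected_components_eq_quotient: "connected_components V E = V // connectivity V E"
  by (simp add: connected_components_def connectivity_def)

lemma equiv_connectivity: "equiv V (connectivity V E)"
proof (rule equivI)
  have "sym (((E \<inter> V \<times> V) \<union> (E \<inter> V \<times> V)\<inverse>)\<^sup>*)"
    by (rule sym_rtrancl) (auto simp: sym_def)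
  then show "sym (connectivity V E)"
    by (auto simp: connectivity_def sym_def)
qed (auto simp: connectivity_def refl_on_def trans_def intro: rtrancl_trans)

lemma connectivity_edge:
  "x \<in> V \<Longrightarrow> y \<in> V \<Longrightarrow> (x, y) \<in> E \<or> (y, x) \<in> E \<Longrightarrow> (x, y) \<in> connectivity V E"
  unfolding connectivity_def by auto

text \<open>
  A map that sends edges to related pairs of an equivalence relation sends whole components to
  classes; it is used for \<open>dominant_rep\<close> and for the inclusion of the dominant elements.
\<close>

lemma connectivity_mono:
  assumes R: "equiv W R" and edge: "\<And>x y. x \<in> V \<Longrightarrow> y \<in> V \<Longrightarrow> (x, y) \<in> E \<Longrightarrow> (h x, h y) \<in> R"
    and h: "\<And>x. x \<in> V \<Longrightarrow> h x \<in> W" and xy: "(x, y) \<in> connectivity V E"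
  shows "(h x, h y) \<in> R"
proof -
  have "x \<in> V" and "(x, y) \<in> ((E \<inter> V \<times> V) \<union> (E \<inter> V \<times> V)\<inverse>)\<^sup>*"
    using xy by (auto simp: connectivity_def)
  from this(2) show ?thesis
  proof (induction rule: rtrancl_induct)
    case base
    show ?case using R h[OF \<open>x \<in> V\<close>] by (auto simp: equiv_def refl_on_def)
  next
    case (step y z)
    then have "(h y, h z) \<in> R"
      using edge equivE[OF R] by (auto dest: symD)
    with step.IH show ?case using R by (meson equivE transD)
  qed
qed

lemma same_class_iff:
  assumes "equiv V R"
  shows "(\<exists>C\<in>V // R. x \<in> C \<and> y \<in> C) \<longleftrightarrow> (x, y) \<in> R"
proof
  assume xy: "(x, y) \<in> R"
  then have "x \<in> V" using assms by (simp add: equiv_class_eq_iff)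
  then show "\<exists>C\<in>V // R. x \<in> C \<and> y \<in> C"
    using xy equiv_class_self[OF assms] by (intro bexI[of _ "R `` {x}"]) (auto intro: quotientI)
next
  assume "\<exists>C\<in>V // R. x \<in> C \<and> y \<in> C"
  then show "(x, y) \<in> R" using assms quotient_eq_iff by metis
qed

lemma dominant_reps_of_f_op_connected:
  assumes n: "n \<ge> 1" and b: "b \<in> crystal n \<Lambda>" and f: "f_op n b = Some c"
  shows "(dominant_rep n c, dominant_rep n b) \<in> connectivity (Bplus_vertices n \<Lambda>) (Bplus_edges n \<Lambda>)"
proof -
  let ?R = "connectivity (Bplus_vertices n \<Lambda>) (Bplus_edges n \<Lambda>)"
  have c: "c \<in> crystal n \<Lambda>" using crystal.f_step[OF b _ f] n by simp
  note vertices = dominant_rep_in_Bplus_vertices[OF b] dominant_rep_in_Bplus_vertices[OF c]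
  have nn: "n \<in> {1..n}" using n by simp
  have s: "weyl_act n (simple_refl n) d = crystal_refl n n d" for d
    using weyl_act_weyl_product[of "[n]" n d] n by simp
  have "simple_refl n \<in> weyl_group n"
    using permutes_weyl_product[of "[n]" n] n by (simp add: weyl_group_def)
  from dominant_rep_weyl_act[OF this]
  have rep: "dominant_rep n (crystal_refl n n d) = dominant_rep n d" for d
    by (simp add: s)
  define d where "d = wt n b n"
  have d: "d = int (count_list b n) - int (count_list b (Suc n))"
    using n by (simp add: d_def wt_def)
  have wt_c: "int (count_list c n) - int (count_list c (Suc n)) = d - 2"
    using count_f_op[OF f, of n] count_f_op[OF f, of "Suc n"] by (simp add: d)
  \<comment> \<open>The weights of \<open>b\<close> and \<open>c\<close> at \<open>n\<close> are \<open>d\<close> and \<open>d - 2\<close>.\<close>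
  consider "d \<ge> 2" | "d = 1" | "d \<le> 0" by linarith
  then show ?thesis
  proof cases
    case 1
    then show ?thesis
      using Bplus_edge_of_f_op[OF n b f] vertices connectivity_edge by (metis d_def)
  next
    case 2
    have "mirrored n b c"
      unfolding mirrored_def by (rule exI[of _ 1]) (use f d 2 in simp)
    then have "dominant_rep n c = dominant_rep n b"
      using crystal_refl_of_mirrored(1)[OF nn] rep by metis
    then show ?thesis
      using vertices equiv_connectivity by (metis equiv_class_eq_iff)
  next
    case 3
    \<comment> \<open>Both elements lie in the lower half of their common \<open>n\<close>-string, so their mirror images \<open>b'\<close> and
      \<open>c'\<close> lie in the upper half, where \<open>c'\<close> precedes \<open>b'\<close>: reaching \<open>c\<close> from \<open>c'\<close> takes two steps
      more than reaching \<open>b\<close> from \<open>b'\<close>.\<close>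
    define b' c' where "b' = crystal_refl n n b" and "c' = crystal_refl n n c"
    have mb: "mirrored n b' b"
    proof (cases "d = 0")
      case True
      then have "mirrored n b b" unfolding mirrored_def by (intro exI[of _ 0]) (simp add: d)
      then show ?thesis unfolding b'_def using crystal_refl_of_mirrored(1)[OF nn] by metis
    next
      case False
      have "\<not> mirrored n b b'" using False 3 by (auto simp: mirrored_def d)
      then show ?thesis using mirrored_crystal_refl[OF nn, of b] by (simp add: b'_def)
    qed
    have mc: "mirrored n c' c"
    proof -
      have "\<not> mirrored n c c'" using 3 wt_c by (auto simp: mirrored_def)
      then show ?thesis using mirrored_crystal_refl[OF nn, of c] by (simp add: c'_def)
    qed
    obtain k where k: "iter_op (f_op n) k b' = Some b" "int k = - d"
    proof -
      obtain k where k: "iter_op (f_op n) k b' = Some b"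
          "int k = int (count_list b' n) - int (count_list b' (Suc n))"
        using mb by (auto simp: mirrored_def)
      then show ?thesis
        using that[of k] iter_f_op_stats[OF k(1), of n] iter_f_op_stats[OF k(1), of "Suc n"] by (simp add: d)
    qed
    obtain l where l: "iter_op (f_op n) l c' = Some c" "int l = int (count_list c' n) - int (count_list c' (Suc n))"
      using mc by (auto simp: mirrored_def)
    have "int l = 2 - d"
      using iter_f_op_stats[OF l(1), of n] iter_f_op_stats[OF l(1), of "Suc n"] l(2) wt_c by simp
    then have "l = Suc (Suc k)" using k(2) by simp
    then have "iter_op (e_op n) (Suc (Suc k)) c = Some c'"
      using l(1) by (simp only: iter_e_op_iff)
    moreover have "e_op n c = Some b" using f by (simp add: e_op_f_op_iff)
    ultimately have "Option.bind (iter_op (e_op n) k b) (e_op n) = Some c'"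
      by (simp only: iter_op_Suc_front[of _ "Suc k"]) simp
    moreover have "iter_op (e_op n) k b = Some b'" using k(1) by (simp add: iter_e_op_iff)
    ultimately have f': "f_op n c' = Some b'" by (simp add: e_op_f_op_iff)
    have "c' \<in> crystal n \<Lambda>" unfolding c'_def by (rule crystal_refl_in_crystal[OF c nn])
    moreover have "wt n c' n \<ge> 2" using l(2) \<open>int l = 2 - d\<close> 3 n by (simp add: wt_def)
    ultimately have "(dominant_rep n b', dominant_rep n c') \<in> Bplus_edges n \<Lambda>"
      using Bplus_edge_of_f_op[OF n _ f'] by blast
    then show ?thesis
      using vertices connectivity_edge by (metis rep b'_def c'_def)
  qed
qed

theorem proposition1p13:
  fixes n :: nat and \<Lambda> :: "nat \<Rightarrow> int"
  assumes "n \<ge> 1" and "\<Lambda> \<in> dominant_weights n"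
  shows "connected_components (crystal n \<Lambda>) (B1_edges n \<Lambda>) = LL_atoms n \<Lambda>"
proof -
  let ?R1 = "connectivity (crystal n \<Lambda>) (B1_edges n \<Lambda>)"
  let ?R = "connectivity (Bplus_vertices n \<Lambda>) (Bplus_edges n \<Lambda>)"
  note R1 = equiv_connectivity[of "crystal n \<Lambda>" "B1_edges n \<Lambda>"]
  note R = equiv_connectivity[of "Bplus_vertices n \<Lambda>" "Bplus_edges n \<Lambda>"]
  have weyl: "(weyl_act n w b, b) \<in> ?R1" if "w \<in> weyl_group n" "b \<in> crystal n \<Lambda>" for w b
    using that weyl_act_in_crystal[OF that]
    by (intro connectivity_edge) (auto simp: B1_edges_def)
  have rep: "(dominant_rep n b, b) \<in> ?R1" if "b \<in> crystal n \<Lambda>" for b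
    using dominant_rep_exists[of n b] weyl[OF _ that] by metis
  have Bplus: "(c, c') \<in> ?R1" if edge: "(c, c') \<in> Bplus_edges n \<Lambda>" for c c'
  proof -
    obtain \<alpha> where \<alpha>: "\<alpha> \<in> positive_roots n" "f_root n \<alpha> c' = Some c" and c: "c' \<in> crystal n \<Lambda>"
      using edge unfolding Bplus_edges_def Bplus_vertices_def by blast
    define w where "w = (SOME w. w \<in> weyl_group n \<and> root_act w (simple_root n) = \<alpha>)"
    have w: "w \<in> weyl_group n"
      using someI_ex[of "\<lambda>w. w \<in> weyl_group n \<and> root_act w (simple_root n) = \<alpha>"]
        weyl_group_transitive_on_roots[OF assms(1) \<alpha>(1)] unfolding w_def by blast
    define b' where "b' = weyl_act n (inv w) c'"
    obtain b where b: "f_op n b' = Some b" "c = weyl_act n w b"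
      using \<alpha>(2) by (auto simp: f_root_def w_def[symmetric] b'_def)
    have b': "b' \<in> crystal n \<Lambda>"
      unfolding b'_def using w c by (intro weyl_act_in_crystal) (simp_all add: weyl_group_closed)
    then have b_in: "b \<in> crystal n \<Lambda>" using crystal.f_step[OF b' _ b(1)] assms(1) by simp
    have "(c, b) \<in> ?R1" using weyl[OF w b_in] b(2) by simp
    moreover have "(b, b') \<in> ?R1"
      using b b' b_in by (intro connectivity_edge) (auto simp: B1_edges_def)
    moreover have "(b', c') \<in> ?R1"
      unfolding b'_def using w c by (intro weyl) (simp_all add: weyl_group_closed)
    ultimately show ?thesis using R1 by (meson equivE transD)
  qed
  have "?R1 = LL_equivalence n \<Lambda>"
  proof (intro set_eqI iffI; clarify)
    fix x y assume xy: "(x, y) \<in> ?R1"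
    have edges: "(dominant_rep n b, dominant_rep n b') \<in> ?R"
      if bb': "b \<in> crystal n \<Lambda>" "b' \<in> crystal n \<Lambda>" "(b, b') \<in> B1_edges n \<Lambda>" for b b'
    proof -
      consider (weyl) w where "w \<in> weyl_group n" "b = weyl_act n w b'" | (f) "f_op n b' = Some b"
        using bb'(3) by (auto simp: B1_edges_def)
      then show ?thesis
      proof cases
        case weyl
        then show ?thesis
          using dominant_rep_weyl_act dominant_rep_in_Bplus_vertices[OF bb'(1)] R
          by (metis equiv_class_eq_iff)
      next
        case f
        then show ?thesis by (rule dominant_reps_of_f_op_connected[OF assms(1) bb'(2)])
      qed
    qed
    have "(dominant_rep n x, dominant_rep n y) \<in> ?R"
      by (rule connectivity_mono[OF R edges dominant_rep_in_Bplus_vertices xy])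
    moreover have "x \<in> crystal n \<Lambda>" "y \<in> crystal n \<Lambda>"
      using xy by (simp_all add: connectivity_def)
    ultimately show "(x, y) \<in> LL_equivalence n \<Lambda>"
      by (simp add: LL_equivalence_def connected_components_eq_quotient same_class_iff[OF R])
  next
    fix x y assume "(x, y) \<in> LL_equivalence n \<Lambda>"
    then have x: "x \<in> crystal n \<Lambda>" and y: "y \<in> crystal n \<Lambda>" and "(dominant_rep n x, dominant_rep n y) \<in> ?R"
      by (simp_all add: LL_equivalence_def connected_components_eq_quotient same_class_iff[OF R])
    have "Bplus_vertices n \<Lambda> \<subseteq> crystal n \<Lambda>" by (auto simp: Bplus_vertices_def)
    then have "(dominant_rep n x, dominant_rep n y) \<in> ?R1"
      using connectivity_mono[OF R1, of "Bplus_vertices n \<Lambda>" "Bplus_edges n \<Lambda>" "\<lambda>x. x"] Bplus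
        \<open>(dominant_rep n x, dominant_rep n y) \<in> ?R\<close> by blast
    with rep[OF x] rep[OF y] show "(x, y) \<in> ?R1"
      using R1 by (meson equivE symD transD)
  qed
  then show ?thesis
    by (simp add: connected_components_eq_quotient LL_atoms_def)
qed

end
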